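(* Let $\mathfrak{F}=\langle F,+,\cdot,0,1,\le\rangle$ be an ordered field and let $d\ge 2$. Then the subset relations between $\mathsf{Conc}(\mathcal{R}el)$, $\mathsf{Conc}(\mathcal{M}ink)$, $\mathsf{Conc}(\mathcal{E}ucl)$, $\mathsf{Conc}(\mathcal{G}al)$, $\mathsf{Conc}(\mathcal{N}ewt)$, $\mathsf{Conc}(\mathcal{LC}lass)$ and $\mathsf{Conc}(\mathcal{OA}ff)$ are as follows: $\mathsf{Conc}(\mathcal{R}el)=\mathsf{Conc}(\mathcal{M}ink)$; $\mathsf{Conc}(\mathcal{OA}ff)$ is contained in all of them; all of them are contained in $\mathsf{Conc}(\mathcal{LC}lass)$; $\mathsf{Conc}(\mathcal{G}al)\subseteq\mathsf{Conc}(\mathcal{N}ewt)$; and, apart from the trivial inclusion of each set in itself, no other inclusions hold among these sets. In more detail: (i) $\mathsf{Conc}(\mathcal{R}el)=\mathsf{Conc}(\mathcal{M}ink)$, i.e., $\mathcal{R}el$ and $\mathcal{M}ink$ are definitionally equivalent. (ii) $\mathsf{Conc}(\mathcal{G}al)\subseteq\mathsf{Conc}(\mathcal{N}ewt)$. (iii) $\mathsf{Conc}(\mathcal{OA}ff)\subseteq\mathsf{Conc}(\mathcal{E}ucl)\cap\mathsf{Conc}(\mathcal{R}el)\cap\mathsf{Conc}(\mathcal{G}al)$. (iv) $\mathsf{Conc}(\mathcal{E}ucl)\cup\mathsf{Conc}(\mathcal{R}el)\cup\mathsf{Conc}(\mathcal{N}ewt)\subseteq\mathsf{Conc}(\mathcal{LC}lass)$.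 (v) Membership of the relations $\cong$, $\cong_\mu$, $\boldsymbol{\lambda}$, $\cong_{\mathsf{S}}$, $\mathsf{S}$, $\mathsf{Rest}$, $\boldsymbol{\delta}$ in the concept-sets is as follows: - $\cong\ \in\mathsf{Conc}(\mathcal{E}ucl)$, and none of $\cong_\mu,\boldsymbol{\lambda},\cong_{\mathsf{S}},\mathsf{S},\mathsf{Rest},\boldsymbol{\delta}$ is in $\mathsf{Conc}(\mathcal{E}ucl)$; - $\cong_\mu,\boldsymbol{\lambda}\in\mathsf{Conc}(\mathcal{R}el)$, and none of $\cong,\cong_{\mathsf{S}},\mathsf{S},\mathsf{Rest},\boldsymbol{\delta}$ is in $\mathsf{Conc}(\mathcal{R}el)$; - $\cong_{\mathsf{S}},\mathsf{S}\in\mathsf{Conc}(\mathcal{G}al)$, and none of $\cong,\cong_\mu,\boldsymbol{\lambda},\mathsf{Rest},\boldsymbol{\delta}$ is in $\mathsf{Conc}(\mathcal{G}al)$; - $\cong_{\mathsf{S}},\mathsf{S},\mathsf{Rest}\in\mathsf{Conc}(\mathcal{N}ewt)$, and none of $\cong,\cong_\mu,\boldsymbol{\lambda},\boldsymbol{\delta}$ is in $\mathsf{Conc}(\mathcal{N}ewt)$; - all of $\cong,\cong_\mu,\boldsymbol{\lambda},\cong_{\mathsf{S}},\mathsf{S},\mathsf{Rest},\boldsymbol{\delta}$ are in $\mathsf{Conc}(\mathcal{LC}lass)$.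
   Context: Concepts. For a first-order structure $\mathfrak{M}$ with universe $M$, an $n$-ary relation $R\subseteq M^n$ is definable in $\mathfrak{M}$ iff there is a first-order formula (without parameters) in the language of $\mathfrak{M}$, with free variables among $v_1,\dots,v_n$, that is satisfied exactly by the tuples in $R$. $\mathsf{Conc}(\mathfrak{M})$ denotes the set of all relations (of all finite arities) on $M$ definable in $\mathfrak{M}$. Two structures with the same universe are definitionally equivalent iff they have the same $\mathsf{Conc}$. Points are $\vec p=\langle p_1,\dots,p_d\rangle\in F^d$. Let $\mathsf{d}^2(\vec p,\vec q)=\sum_{i=1}^d(p_i-q_i)^2$ and $\mathsf{d}_\mu^2(\vec p,\vec q)=(p_1-q_1)^2-\sum_{i=2}^d(p_i-q_i)^2$. Relations on $F^d$: - $\mathsf{Bw}(\vec p,\vec q,\vec r)$ iff $\vec q=\vec p+t(\vec r-\vec p)$ for some $t\in F$ with $0\le t\le 1$; - $\vec p\,\mathsf{S}\,\vec q$ iff $p_1=q_1$; - $\vec p\,\mathsf{Rest}\,\vec q$ iff $p_i=q_i$ for all $i\in\{2,\dots,d\}$; - $\vec p\,\boldsymbol{\lambda}\,\vec q$ iff $(p_1-q_1)^2=(p_2-q_2)^2+\dots+(p_d-q_d)^2$; - $(\vec p,\vec q)\cong(\vec r,\vec s)$ iff $\mathsf{d}^2(\vec p,\vec q)=\mathsf{d}^2(\vec r,\vec s)$; - $(\vec p,\vec q)\cong_\mu(\vec r,\vec s)$ iff $\mathsf{d}_\mu^2(\vec p,\vec q)=\mathsf{d}_\mu^2(\vec r,\vec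 s)$; - $(\vec p,\vec q)\cong_{\mathsf{S}}(\vec r,\vec s)$ iff $(\vec p,\vec q)\cong(\vec r,\vec s)$ and $\vec p\,\mathsf{S}\,\vec q$ and $\vec r\,\mathsf{S}\,\vec s$; - $\boldsymbol{\delta}(\vec p,\vec q,\vec r)$ iff $\vec p\,\mathsf{S}\,\vec q$ and $\vec p\,\boldsymbol{\lambda}\,\vec r$. Structures (all with universe $F^d$ and only the listed relations): $\mathcal{OA}ff=\langle F^d,\mathsf{Bw}\rangle$; $\mathcal{E}ucl=\langle F^d,\cong,\mathsf{Bw}\rangle$; $\mathcal{R}el=\langle F^d,\boldsymbol{\lambda},\mathsf{Bw}\rangle$; $\mathcal{M}ink=\langle F^d,\cong_\mu,\mathsf{Bw}\rangle$; $\mathcal{G}al=\langle F^d,\cong_{\mathsf{S}},\mathsf{Bw}\rangle$; $\mathcal{N}ewt=\langle F^d,\cong_{\mathsf{S}},\mathsf{Bw},\mathsf{Rest}\rangle$; $\mathcal{LC}lass=\langle F^d,\cong_{\mathsf{S}},\mathsf{Bw},\boldsymbol{\lambda}\rangle$. *)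

theory Defs
  imports "HOL-Library.FuncSet"
begin

section \<open>First-order definability in relational structures\<close>

text \<open>
  An \<open>n\<close>-ary relation on \<open>M\<close> is a set of lists of length \<open>n\<close> over \<open>M\<close>.  A structure lists its
  relations together with their arities; the \<open>k\<close>-th entry interprets the \<open>k\<close>-th relation symbol of
  its language.
\<close>

record 'm rel_structure =
  universe :: "'m set"
  relations :: "(nat \<times> 'm list set) list"

datatype fm =
    Equal nat nat
  | Atom nat "nat list"
  | Neg fm
  | Conj fm fm
  | Forall nat fm

primrec free_vars :: "fm \<Rightarrow> nat set" where
  "free_vars (Equal x y) = {x, y}"
| "free_vars (Atom k xs) = set xs"
| "free_vars (Neg \<phi>) = free_vars \<phi>"
| "free_vars (Conj \<phi> \<psi>) = free_vars \<phi> \<union> free_vars \<psi>"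
| "free_vars (Forall x \<phi>) = free_vars \<phi> - {x}"

primrec in_language :: "'m rel_structure \<Rightarrow> fm \<Rightarrow> bool" where
  "in_language A (Equal x y) \<longleftrightarrow> True"
| "in_language A (Atom k xs) \<longleftrightarrow>
     k < length (relations A) \<and> length xs = fst (relations A ! k)"
| "in_language A (Neg \<phi>) \<longleftrightarrow> in_language A \<phi>"
| "in_language A (Conj \<phi> \<psi>) \<longleftrightarrow> in_language A \<phi> \<and> in_language A \<psi>"
| "in_language A (Forall x \<phi>) \<longleftrightarrow> in_language A \<phi>"

primrec sat :: "'m rel_structure \<Rightarrow> (nat \<Rightarrow> 'm) \<Rightarrow> fm \<Rightarrow> bool" where
  "sat A e (Equal x y) \<longleftrightarrow> e x = e y"
| "sat A e (Atom k xs) \<longleftrightarrow> map e xs \<in> snd (relations A ! k)"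
| "sat A e (Neg \<phi>) \<longleftrightarrow> \<not> sat A e \<phi>"
| "sat A e (Conj \<phi> \<psi>) \<longleftrightarrow> sat A e \<phi> \<and> sat A e \<psi>"
| "sat A e (Forall x \<phi>) \<longleftrightarrow> (\<forall>a\<in>universe A. sat A (e(x := a)) \<phi>)"

text \<open>
  Variables are numbered from \<open>0\<close>, so that variable \<open>i\<close> takes the value \<open>as ! i\<close>; the values
  of \<open>(!) as\<close> beyond the length of \<open>as\<close> are irrelevant because of the condition on
  \<^const>\<open>free_vars\<close>.
\<close>

definition definable :: "'m rel_structure \<Rightarrow> nat \<Rightarrow> 'm list set \<Rightarrow> bool" where
  "definable A n R \<longleftrightarrow>
     (\<exists>\<phi>. in_language A \<phi> \<and> free_vars \<phi> \<subseteq> {..<n} \<and>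
       R = {as. length as = n \<and> set as \<subseteq> universe A \<and> sat A ((!) as) \<phi>})"

definition Conc :: "'m rel_structure \<Rightarrow> 'm list set set" where
  "Conc A = {R. \<exists>n. definable A n R}"

definition definitionally_equivalent :: "'m rel_structure \<Rightarrow> 'm rel_structure \<Rightarrow> bool" where
  "definitionally_equivalent A B \<longleftrightarrow> universe A = universe B \<and> Conc A = Conc B"


section \<open>Relations on the coordinate space over an ordered field\<close>

text \<open>
  A point is a function on the index set \<open>{1..d}\<close>, extended by \<^const>\<open>undefined\<close> outside it.
\<close>

type_synonym 'a point = "nat \<Rightarrow> 'a"

definition points :: "nat \<Rightarrow> 'a::linordered_field point set" where
  "points d = {1..d} \<rightarrow>\<^sub>E UNIV"

definition dist2 :: "nat \<Rightarrow> 'a::linordered_field point \<Rightarrow> 'a point \<Rightarrow> 'a" where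
  "dist2 d p q = (\<Sum>i=1..d. (p i - q i)\<^sup>2)"

definition mdist2 :: "nat \<Rightarrow> 'a::linordered_field point \<Rightarrow> 'a point \<Rightarrow> 'a" where
  "mdist2 d p q = (p 1 - q 1)\<^sup>2 - (\<Sum>i=2..d. (p i - q i)\<^sup>2)"

definition Bw :: "nat \<Rightarrow> 'a::linordered_field point list set" where
  "Bw d = {[p, q, r] | p q r. p \<in> points d \<and> q \<in> points d \<and> r \<in> points d \<and>
     (\<exists>t. 0 \<le> t \<and> t \<le> 1 \<and> (\<forall>i\<in>{1..d}. q i = p i + t * (r i - p i)))}"

definition Simul :: "nat \<Rightarrow> 'a::linordered_field point list set" where
  "Simul d = {[p, q] | p q. p \<in> points d \<and> q \<in> points d \<and> p 1 = q 1}"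

definition Rest :: "nat \<Rightarrow> 'a::linordered_field point list set" where
  "Rest d = {[p, q] | p q. p \<in> points d \<and> q \<in> points d \<and> (\<forall>i\<in>{2..d}. p i = q i)}"

definition Light :: "nat \<Rightarrow> 'a::linordered_field point list set" where
  "Light d = {[p, q] | p q. p \<in> points d \<and> q \<in> points d \<and>
     (p 1 - q 1)\<^sup>2 = (\<Sum>i=2..d. (p i - q i)\<^sup>2)}"

definition Cong :: "nat \<Rightarrow> 'a::linordered_field point list set" where
  "Cong d = {[p, q, r, s] | p q r s.
     p \<in> points d \<and> q \<in> points d \<and> r \<in> points d \<and> s \<in> points d \<and>
     dist2 d p q = dist2 d r s}"

definition Cong_mu :: "nat \<Rightarrow> 'a::linordered_field point list set" where
  "Cong_mu d = {[p, q, r, s] | p q r s.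
     p \<in> points d \<and> q \<in> points d \<and> r \<in> points d \<and> s \<in> points d \<and>
     mdist2 d p q = mdist2 d r s}"

definition Cong_S :: "nat \<Rightarrow> 'a::linordered_field point list set" where
  "Cong_S d = {[p, q, r, s] | p q r s.
     [p, q, r, s] \<in> Cong d \<and> [p, q] \<in> Simul d \<and> [r, s] \<in> Simul d}"

definition Delta :: "nat \<Rightarrow> 'a::linordered_field point list set" where
  "Delta d = {[p, q, r] | p q r. [p, q] \<in> Simul d \<and> [p, r] \<in> Light d}"


section \<open>The structures\<close>

datatype geometry = OAff | Eucl | Rel | Mink | Gal | Newt | LClass

text \<open>The argument of type \<^typ>\<open>'a itself\<close> only determines the field.\<close>

primrec geom :: "'a::linordered_field itself \<Rightarrow> nat \<Rightarrow> geometry \<Rightarrow> 'a point rel_structure" where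
  "geom F d OAff = \<lparr>universe = points d, relations = [(3, Bw d)]\<rparr>"
| "geom F d Eucl = \<lparr>universe = points d, relations = [(4, Cong d), (3, Bw d)]\<rparr>"
| "geom F d Rel = \<lparr>universe = points d, relations = [(2, Light d), (3, Bw d)]\<rparr>"
| "geom F d Mink = \<lparr>universe = points d, relations = [(4, Cong_mu d), (3, Bw d)]\<rparr>"
| "geom F d Gal = \<lparr>universe = points d, relations = [(4, Cong_S d), (3, Bw d)]\<rparr>"
| "geom F d Newt = \<lparr>universe = points d, relations = [(4, Cong_S d), (3, Bw d), (2, Rest d)]\<rparr>"
| "geom F d LClass = \<lparr>universe = points d, relations = [(4, Cong_S d), (3, Bw d), (2, Light d)]\<rparr>"

end

theory Submission
  imports Defs "HOL-Library.Function_Algebras"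
begin

text \<open>
  Inclusions between concept sets reduce to the membership of single relations: if \<open>B\<close> defines the
  relations of \<open>A\<close>, then \<open>B\<close> defines everything that \<open>A\<close> defines (\<open>Conc_subsetI\<close>).

  The definitions have to work over an arbitrary ordered field, where lengths need not exist, but
  bilinear algebra is available.  From \<^const>\<open>Bw\<close> one defines collinearity, parallelism,
  parallelograms and hence equality of vectors.  From lightlikeness one defines Minkowski
  orthogonality: a non-null line through the tip of a null vector is orthogonal to the vector
  iff it meets the light cone only there (\<open>orthogonal_to_lightlike_iff\<close>), and every other
  vector is the diagonal of a parallelogram with null sides, whose second diagonal is
  orthogonal to it (\<open>orthogonal_to_nonlightlike_iff\<close>).  Since
  two vectors have the same square iff their sum and difference are orthogonal, this yields
  \<^const>\<open>Cong_mu\<close> (\<open>Cong_mu_iff\<close>) and the equivalence of \<^const>\<open>Rel\<close> and \<^const>\<open>Mink\<close>.  In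
  \<^const>\<open>LClass\<close> the point at rest is the centre of a sphere in which a light cone meets a
  simultaneity hyperplane (\<open>Rest_iff_sphere_centre\<close>).  The reflection in such hyperplanes turns
  Minkowski into Euclidean orthogonality, and \<^const>\<open>Cong\<close> is obtained like \<^const>\<open>Cong_mu\<close>
  (\<open>Cong_iff\<close>).

  Everything else is undefinable by a symmetry argument (\<open>Conc_automorphism\<close>).  One rational linear
  map for each structure suffices: a rotation for \<^const>\<open>Eucl\<close>, a Lorentz boost for
  \<^const>\<open>Rel\<close>, a Galilean boost for \<^const>\<open>Gal\<close>, and a change of the unit of time for
  \<^const>\<open>Newt\<close>.
\<close>

section \<open>Expressible conditions on assignments\<close>

text \<open>A condition on assignments may mention any variable, and it is the meaning of a formula, not its
  text, that matters.  This makes expressible conditions closed under the logical operations without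
  any book-keeping of arities; the passage back to \<^const>\<open>Conc\<close> is made once, in
  \<open>Conc_if_expressible\<close>.\<close>

definition expressible :: "'m rel_structure \<Rightarrow> ((nat \<Rightarrow> 'm) \<Rightarrow> bool) \<Rightarrow> bool" where
  "expressible A P \<longleftrightarrow>
     (\<exists>\<phi>. in_language A \<phi> \<and> (\<forall>e. range e \<subseteq> universe A \<longrightarrow> (sat A e \<phi> \<longleftrightarrow> P e)))"

lemma finite_free_vars: "finite (free_vars \<phi>)"
  by (induction \<phi>) auto

lemma sat_cong: "(\<And>x. x \<in> free_vars \<phi> \<Longrightarrow> e x = e' x) \<Longrightarrow> sat A e \<phi> \<longleftrightarrow> sat A e' \<phi>"
proof (induction \<phi> arbitrary: e e')
  case (Atom k xs)
  then have "map e xs = map e' xs" by simp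
  then show ?case by (simp only: sat.simps)
next
  case (Conj \<phi> \<psi>)
  have "sat A e \<phi> \<longleftrightarrow> sat A e' \<phi>" "sat A e \<psi> \<longleftrightarrow> sat A e' \<psi>"
    using Conj.prems by (auto intro!: Conj.IH)
  then show ?case by simp
next
  case (Forall x \<phi>)
  have "sat A (e(x := a)) \<phi> \<longleftrightarrow> sat A (e'(x := a)) \<phi>" for a
    using Forall.prems by (intro Forall.IH) auto
  then show ?case by simp
next
  case (Neg \<phi>)
  have "sat A e \<phi> \<longleftrightarrow> sat A e' \<phi>"
    using Neg.prems by (auto intro!: Neg.IH)
  then show ?case by simp
qed simp

text \<open>Substitution of variables for variables.  A bound variable has to be renamed away from the images
  of the free ones; the bound on the free variables of \<open>\<psi>\<close> allows
  a formula to be fitted to the variables of a given arity.\<close>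

lemma rename_formula:
  assumes "in_language A \<phi>"
  shows "\<exists>\<psi>. in_language A \<psi> \<and> free_vars \<psi> \<subseteq> \<sigma> ` free_vars \<phi> \<and>
    (\<forall>e. sat A e \<psi> \<longleftrightarrow> sat A (e \<circ> \<sigma>) \<phi>)"
  using assms
proof (induction \<phi> arbitrary: \<sigma>)
  case (Equal x y)
  show ?case by (rule exI[of _ "Equal (\<sigma> x) (\<sigma> y)"]) auto
next
  case (Atom k xs)
  then show ?case by (intro exI[of _ "Atom k (map \<sigma> xs)"]) (auto simp: comp_def)
next
  case (Neg \<phi>)
  then obtain \<psi> where "in_language A \<psi>" "free_vars \<psi> \<subseteq> \<sigma> ` free_vars \<phi>"
    "\<forall>e. sat A e \<psi> \<longleftrightarrow> sat A (e \<circ> \<sigma>) \<phi>"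
    by fastforce
  then show ?case by (intro exI[of _ "Neg \<psi>"]) (auto simp: comp_def)
next
  case (Conj \<phi> \<phi>')
  then have "in_language A \<phi>" "in_language A \<phi>'" by auto
  from Conj.IH(1)[OF this(1), of \<sigma>] Conj.IH(2)[OF this(2), of \<sigma>]
  obtain \<psi> \<psi>' where "in_language A \<psi>" "free_vars \<psi> \<subseteq> \<sigma> ` free_vars \<phi>"
    "\<forall>e. sat A e \<psi> \<longleftrightarrow> sat A (e \<circ> \<sigma>) \<phi>"
    "in_language A \<psi>'" "free_vars \<psi>' \<subseteq> \<sigma> ` free_vars \<phi>'"
    "\<forall>e. sat A e \<psi>' \<longleftrightarrow> sat A (e \<circ> \<sigma>) \<phi>'"
    by blast
  then show ?case by (intro exI[of _ "Conj \<psi> \<psi>'"]) (auto simp: comp_def)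
next
  case (Forall x \<phi>)
  \<comment> \<open>A variable that avoids capture.\<close>
  have "\<exists>y. y \<notin> \<sigma> ` free_vars \<phi>"
    using finite_free_vars by (intro ex_new_if_finite) auto
  then obtain y where y: "y \<notin> \<sigma> ` free_vars \<phi>" by blast
  obtain \<psi> where \<psi>: "in_language A \<psi>" "free_vars \<psi> \<subseteq> \<sigma>(x := y) ` free_vars \<phi>"
    "\<forall>e. sat A e \<psi> \<longleftrightarrow> sat A (e \<circ> \<sigma>(x := y)) \<phi>"
    using Forall.IH[of "\<sigma>(x := y)"] Forall.prems unfolding in_language.simps by blast
  have "sat A (e(y := a) \<circ> \<sigma>(x := y)) \<phi> \<longleftrightarrow> sat A ((e \<circ> \<sigma>)(x := a)) \<phi>" for e a
    using y by (intro sat_cong) auto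
  moreover have "free_vars (Forall y \<psi>) \<subseteq> \<sigma> ` free_vars (Forall x \<phi>)"
    using \<psi>(2) by (auto split: if_splits)
  ultimately show ?case
    using \<psi> by (intro exI[of _ "Forall y \<psi>"]) (auto simp: comp_def)
qed

lemma expressible_eq: "expressible A (\<lambda>e. e i = e j)"
  unfolding expressible_def by (intro exI[of _ "Equal i j"]) auto

lemma expressible_not: "expressible A P \<Longrightarrow> expressible A (\<lambda>e. \<not> P e)"
proof -
  assume "expressible A P"
  then obtain \<phi> where "in_language A \<phi>" "\<forall>e. range e \<subseteq> universe A \<longrightarrow> (sat A e \<phi> \<longleftrightarrow> P e)"
    unfolding expressible_def by blast
  then show ?thesis
    unfolding expressible_def by (intro exI[of _ "Neg \<phi>"]) simp
qed

lemma expressible_conj: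
  "expressible A P \<Longrightarrow> expressible A Q \<Longrightarrow> expressible A (\<lambda>e. P e \<and> Q e)"
proof -
  assume "expressible A P" "expressible A Q"
  then obtain \<phi> \<psi> where
    "in_language A \<phi>" "\<forall>e. range e \<subseteq> universe A \<longrightarrow> (sat A e \<phi> \<longleftrightarrow> P e)"
    "in_language A \<psi>" "\<forall>e. range e \<subseteq> universe A \<longrightarrow> (sat A e \<psi> \<longleftrightarrow> Q e)"
    unfolding expressible_def by blast
  then show ?thesis
    unfolding expressible_def by (intro exI[of _ "Conj \<phi> \<psi>"]) simp
qed

lemma expressible_disj:
  "expressible A P \<Longrightarrow> expressible A Q \<Longrightarrow> expressible A (\<lambda>e. P e \<or> Q e)"
  using expressible_not[OF expressible_conj[OF expressible_not expressible_not], of A P Q] by simp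

lemma expressible_imp:
  "expressible A P \<Longrightarrow> expressible A Q \<Longrightarrow> expressible A (\<lambda>e. P e \<longrightarrow> Q e)"
  using expressible_disj[OF expressible_not, of A P Q] by (simp only: imp_conv_disj)

lemma expressible_cong:
  assumes "\<And>e. (\<And>i. e i \<in> universe A) \<Longrightarrow> P e \<longleftrightarrow> Q e" and "expressible A Q"
  shows "expressible A P"
proof -
  have "P e \<longleftrightarrow> Q e" if "range e \<subseteq> universe A" for e
    by (rule assms(1)) (use that in blast)
  moreover obtain \<phi> where "in_language A \<phi>"
    "\<And>e. range e \<subseteq> universe A \<Longrightarrow> sat A e \<phi> \<longleftrightarrow> Q e"
    using assms(2) unfolding expressible_def by blast
  ultimately show ?thesis
    unfolding expressible_def by (intro exI[of _ \<phi>]) simp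
qed

text \<open>The assumption is in de Bruijn style: in it, variable \<open>0\<close> is the quantified one and all others are
  shifted by one.  In this form the rule is found by higher-order pattern unification, so that the
  expressibility of a concrete condition follows by backward chaining along its logical structure.\<close>

lemma expressible_all:
  assumes "expressible A (\<lambda>e. P (\<lambda>i. e (Suc i)) (e 0))"
  shows "expressible A (\<lambda>e. \<forall>a\<in>universe A. P e a)"
proof -
  obtain \<phi> where \<phi>: "in_language A \<phi>"
    "\<And>e. range e \<subseteq> universe A \<Longrightarrow> sat A e \<phi> \<longleftrightarrow> P (\<lambda>i. e (Suc i)) (e 0)"
    using assms unfolding expressible_def by blast
  obtain N where N: "\<forall>x\<in>free_vars \<phi>. x < N"
    using finite_free_vars by (metis finite_nat_set_iff_bounded)
  define \<sigma> where "\<sigma> = (\<lambda>i. case i of 0 \<Rightarrow> N | Suc j \<Rightarrow> j)"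
  obtain \<psi> where \<psi>: "in_language A \<psi>" "\<And>e. sat A e \<psi> \<longleftrightarrow> sat A (e \<circ> \<sigma>) \<phi>"
    using rename_formula[OF \<phi>(1)] by metis
  have "sat A (e(N := a)) \<psi> \<longleftrightarrow> P e a" if e: "range e \<subseteq> universe A" and a: "a \<in> universe A" for e a
  proof -
    have "sat A (e(N := a)) \<psi> \<longleftrightarrow> sat A (case_nat a e) \<phi>"
      unfolding \<psi>(2) using N by (intro sat_cong) (auto simp: \<sigma>_def split: nat.splits)
    also have "\<dots> \<longleftrightarrow> P e a"
      using e a by (subst \<phi>(2)) (auto simp: image_subset_iff split: nat.splits)
    finally show ?thesis .
  qed
  then show ?thesis
    unfolding expressible_def using \<psi>(1) by (intro exI[of _ "Forall N \<psi>"]) auto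
qed

lemma expressible_ex:
  assumes "expressible A (\<lambda>e. P (\<lambda>i. e (Suc i)) (e 0))"
  shows "expressible A (\<lambda>e. \<exists>a\<in>universe A. P e a)"
  using expressible_not[OF expressible_all[where P = "\<lambda>e a. \<not> P e a", OF expressible_not[OF assms]]]
  by simp

text \<open>The arity of \<open>R\<close> may differ from the length of \<open>xs\<close>; the condition is then false everywhere.\<close>

lemma expressible_Conc:
  assumes "R \<in> Conc A"
  shows "expressible A (\<lambda>e. map e xs \<in> R)"
proof -
  obtain n \<phi> where \<phi>: "in_language A \<phi>" "free_vars \<phi> \<subseteq> {..<n}"
    "R = {as. length as = n \<and> set as \<subseteq> universe A \<and> sat A ((!) as) \<phi>}"
    using assms unfolding Conc_def definable_def by blast
  obtain \<psi> where \<psi>: "in_language A \<psi>" "\<And>e. sat A e \<psi> \<longleftrightarrow> sat A (e \<circ> (!) xs) \<phi>"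
    using rename_formula[OF \<phi>(1)] by metis
  show ?thesis
  proof (cases "length xs = n")
    case True
    then have "sat A ((!) (map e xs)) \<phi> \<longleftrightarrow> sat A e \<psi>" for e
      unfolding \<psi>(2) using \<phi>(2) by (intro sat_cong) auto
    then have "map e xs \<in> R \<longleftrightarrow> sat A e \<psi>" if "range e \<subseteq> universe A" for e
      using that True by (auto simp: \<phi>(3))
    then show ?thesis
      unfolding expressible_def using \<psi>(1) by blast
  next
    case False
    then have "map e xs \<notin> R" for e by (auto simp: \<phi>(3))
    then show ?thesis
      using expressible_not[OF expressible_eq[of A 0 0]] by simp
  qed
qed

lemma expressible_Conc2: "R \<in> Conc A \<Longrightarrow> expressible A (\<lambda>e. [e i, e j] \<in> R)"
  using expressible_Conc[of R A "[i, j]"] by simp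

lemma expressible_Conc3: "R \<in> Conc A \<Longrightarrow> expressible A (\<lambda>e. [e i, e j, e k] \<in> R)"
  using expressible_Conc[of R A "[i, j, k]"] by simp

lemma expressible_Conc4: "R \<in> Conc A \<Longrightarrow> expressible A (\<lambda>e. [e i, e j, e k, e l] \<in> R)"
  using expressible_Conc[of R A "[i, j, k, l]"] by simp

text \<open>A formula that expresses the condition may have variables beyond \<open>n\<close>, on which its meaning does
  not depend.  They are all identified with variable \<open>n\<close>, which is then bound by a quantifier; here
  the universe must have an element.\<close>

lemma Conc_if_expressible:
  assumes "expressible A (\<lambda>e. map e [0..<n] \<in> R)"
    and R: "\<And>as. as \<in> R \<Longrightarrow> length as = n \<and> set as \<subseteq> universe A"
    and "universe A \<noteq> {}"
  shows "R \<in> Conc A"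
proof -
  obtain \<phi> where \<phi>: "in_language A \<phi>"
    "\<And>e. range e \<subseteq> universe A \<Longrightarrow> sat A e \<phi> \<longleftrightarrow> map e [0..<n] \<in> R"
    using assms(1) unfolding expressible_def by blast
  define \<sigma> where "\<sigma> = (\<lambda>i. if i < n then i else n)"
  obtain \<psi> where \<psi>: "in_language A \<psi>" "free_vars \<psi> \<subseteq> \<sigma> ` free_vars \<phi>"
    "\<And>e. sat A e \<psi> \<longleftrightarrow> sat A (e \<circ> \<sigma>) \<phi>"
    using rename_formula[OF \<phi>(1)] by metis
  have "sat A (((!) as)(n := a)) \<psi> \<longleftrightarrow> as \<in> R"
    if "length as = n" "set as \<subseteq> universe A" "a \<in> universe A" for as a
  proof -
    have "range (((!) as)(n := a) \<circ> \<sigma>) \<subseteq> universe A"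
      using that by (auto simp: \<sigma>_def dest: nth_mem)
    moreover have "map (((!) as)(n := a) \<circ> \<sigma>) [0..<n] = as"
      using that by (intro nth_equalityI) (auto simp: \<sigma>_def)
    ultimately show ?thesis by (simp add: \<psi>(3) \<phi>(2))
  qed
  then have "sat A ((!) as) (Forall n \<psi>) \<longleftrightarrow> as \<in> R"
    if "length as = n" "set as \<subseteq> universe A" for as
    using that \<open>universe A \<noteq> {}\<close> by (metis ex_in_conv sat.simps(5))
  then have "R = {as. length as = n \<and> set as \<subseteq> universe A \<and> sat A ((!) as) (Forall n \<psi>)}"
    using R by blast
  moreover have "free_vars (Forall n \<psi>) \<subseteq> {..<n}"
    using \<psi>(2) by (auto simp: \<sigma>_def split: if_splits)
  ultimately show ?thesis
    unfolding Conc_def definable_def using \<psi>(1) in_language.simps(5) by blast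
qed

text \<open>Every atomic formula of \<open>A\<close> can be replaced by a formula of \<open>B\<close>.\<close>

lemma Conc_subsetI:
  assumes U: "universe A = universe B" "universe B \<noteq> {}"
    and rel: "\<And>n R. (n, R) \<in> set (relations A) \<Longrightarrow> R \<in> Conc B"
  shows "Conc A \<subseteq> Conc B"
proof
  have *: "in_language A \<phi> \<Longrightarrow> expressible B (\<lambda>e. sat A e \<phi>)" for \<phi>
  proof (induction \<phi>)
    case (Atom k xs)
    then show ?case
      by (auto intro!: expressible_Conc rel[of "fst (relations A ! k)"])
  next
    case (Forall x \<phi>)
    then obtain \<psi> where "in_language B \<psi>"
      "\<And>e. range e \<subseteq> universe B \<Longrightarrow> sat B e \<psi> \<longleftrightarrow> sat A e \<phi>"
      unfolding expressible_def by auto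
    moreover have "range (e(x := a)) \<subseteq> universe B" if "range e \<subseteq> universe B" "a \<in> universe B" for e a
      using that by auto
    ultimately show ?case
      unfolding expressible_def by (intro exI[of _ "Forall x \<psi>"]) (simp add: U)
  qed (auto intro: expressible_eq expressible_not expressible_conj)
  fix R assume "R \<in> Conc A"
  then obtain n \<phi> where \<phi>: "in_language A \<phi>" "free_vars \<phi> \<subseteq> {..<n}"
    "R = {as. length as = n \<and> set as \<subseteq> universe A \<and> sat A ((!) as) \<phi>}"
    unfolding Conc_def definable_def by blast
  have "map e [0..<n] \<in> R \<longleftrightarrow> sat A e \<phi>" if "\<And>i. e i \<in> universe B" for e
  proof -
    have "sat A ((!) (map e [0..<n])) \<phi> \<longleftrightarrow> sat A e \<phi>"
      using \<phi>(2) by (intro sat_cong) auto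
    with that show ?thesis by (auto simp: \<phi>(3) U)
  qed
  then have "expressible B (\<lambda>e. map e [0..<n] \<in> R)"
    by (rule expressible_cong[OF _ *[OF \<phi>(1)]])
  then show "R \<in> Conc B"
    by (rule Conc_if_expressible) (auto simp: \<phi>(3) U)
qed

text \<open>The tool for all undefinability results: what is definable is invariant under automorphisms.\<close>

lemma Conc_automorphism:
  assumes f: "f ` universe A = universe A"
      "\<And>x y. x \<in> universe A \<Longrightarrow> y \<in> universe A \<Longrightarrow> f x = f y \<Longrightarrow> x = y"
    and rel: "\<And>n S as. (n, S) \<in> set (relations A) \<Longrightarrow> set as \<subseteq> universe A \<Longrightarrow>
      map f as \<in> S \<longleftrightarrow> as \<in> S"
    and R: "R \<in> Conc A" and as: "as \<in> R"
  shows "map f as \<in> R"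
proof -
  obtain n \<phi> where \<phi>: "in_language A \<phi>" "free_vars \<phi> \<subseteq> {..<n}"
    "R = {as. length as = n \<and> set as \<subseteq> universe A \<and> sat A ((!) as) \<phi>}"
    using R unfolding Conc_def definable_def by blast
  have *: "sat A (f \<circ> e) \<psi> \<longleftrightarrow> sat A e \<psi>"
    if "in_language A \<psi>" "e ` free_vars \<psi> \<subseteq> universe A" for e \<psi>
    using that
  proof (induction \<psi> arbitrary: e)
    case (Equal x y)
    then show ?case using f(2) by auto
  next
    case (Atom k xs)
    then show ?case
      using rel[of "fst (relations A ! k)" "snd (relations A ! k)" "map e xs"] by (auto simp: comp_def)
  next
    case (Conj \<psi> \<psi>')
    then show ?case by (simp add: image_Un)
  next
    case (Forall x \<psi>)
    have "sat A ((f \<circ> e)(x := f a)) \<psi> \<longleftrightarrow> sat A (e(x := a)) \<psi>" if "a \<in> universe A" for a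
    proof -
      have "(f \<circ> e)(x := f a) = f \<circ> e(x := a)" by auto
      then show ?thesis using Forall that by (auto intro!: Forall.IH simp: image_subset_iff)
    qed
    then have "(\<forall>b\<in>f ` universe A. sat A ((f \<circ> e)(x := b)) \<psi>) \<longleftrightarrow>
        (\<forall>a\<in>universe A. sat A (e(x := a)) \<psi>)"
      by simp
    then show ?case unfolding f(1) by (simp add: comp_def)
  qed simp
  have "sat A ((!) (map f as)) \<phi> \<longleftrightarrow> sat A (f \<circ> (!) as) \<phi>"
    using as \<phi>(2) by (intro sat_cong) (auto simp: \<phi>(3))
  moreover have "(!) as ` free_vars \<phi> \<subseteq> universe A"
    using as \<phi>(2) by (auto simp: \<phi>(3) subset_iff)
  ultimately show ?thesis
    using as *[OF \<phi>(1), of "(!) as"] f(1) by (auto simp: \<phi>(3) subset_iff)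
qed

section \<open>Points and vectors\<close>

definition scale :: "'a::field \<Rightarrow> (nat \<Rightarrow> 'a) \<Rightarrow> nat \<Rightarrow> 'a" (infixr "\<cdot>" 75) where
  "c \<cdot> v = (\<lambda>i. c * v i)"

lemma scale_apply [simp]: "(c \<cdot> v) i = c * v i"
  by (simp add: scale_def)

lemma scale_0_left [simp]: "0 \<cdot> v = 0" and scale_1_left [simp]: "1 \<cdot> v = v"
  by (simp_all add: fun_eq_iff)

text \<open>The difference of two points is a function that vanishes outside \<open>{1..d}\<close>, because
  \<open>undefined - undefined = 0\<close>; likewise a point plus such a function is again a point.  So with
  pointwise addition, \<^const>\<open>points\<close> is an affine space over these functions.\<close>

definition vecs :: "nat \<Rightarrow> (nat \<Rightarrow> 'a::field) set" where
  "vecs d = {v. \<forall>i. i \<notin> {1..d} \<longrightarrow> v i = 0}"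

lemma vecs_closed [simp]:
  "u \<in> vecs d \<Longrightarrow> v \<in> vecs d \<Longrightarrow> u + v \<in> vecs d"
  "u \<in> vecs d \<Longrightarrow> v \<in> vecs d \<Longrightarrow> u - v \<in> vecs d"
  "v \<in> vecs d \<Longrightarrow> c \<cdot> v \<in> vecs d"
  by (auto simp: vecs_def)

lemma points_diff [simp]: "p \<in> points d \<Longrightarrow> q \<in> points d \<Longrightarrow> q - p \<in> vecs d"
  by (auto simp: vecs_def points_def PiE_def extensional_def)

lemma points_add [simp]: "p \<in> points d \<Longrightarrow> v \<in> vecs d \<Longrightarrow> p + v \<in> points d"
  by (auto simp: vecs_def points_def PiE_def extensional_def)

lemma points_eqI: "p \<in> points d \<Longrightarrow> q \<in> points d \<Longrightarrow> (\<And>i. i \<in> {1..d} \<Longrightarrow> p i = q i) \<Longrightarrow> p = q"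
  unfolding points_def by (rule PiE_ext)

lemma points_nonempty: "points d \<noteq> {}"
  by (simp add: points_def PiE_eq_empty_iff)

section \<open>Collinearity, parallelism and translation from betweenness\<close>

definition collinear :: "(nat \<Rightarrow> 'a::field) \<Rightarrow> (nat \<Rightarrow> 'a) \<Rightarrow> (nat \<Rightarrow> 'a) \<Rightarrow> bool" where
  "collinear p q r \<longleftrightarrow> p = q \<or> (\<exists>t. r = p + t \<cdot> (q - p))"

text \<open>Directions are compared up to a nonzero factor, and a line counts as parallel to itself.\<close>

definition parallel where
  "parallel p q r s \<longleftrightarrow> p \<noteq> q \<and> r \<noteq> s \<and> (\<exists>t. s - r = t \<cdot> (q - p))"

definition parallelogram where
  "parallelogram p q r s \<longleftrightarrow> \<not> collinear p q r \<and> q - p = s - r"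

lemma collinearI [intro]: "r = p + t \<cdot> (q - p) \<Longrightarrow> collinear p q r"
  by (auto simp: collinear_def)

lemma Bw_iff:
  assumes "p \<in> points d" "q \<in> points d" "r \<in> points d"
  shows "[p, q, r] \<in> Bw d \<longleftrightarrow> (\<exists>t. 0 \<le> t \<and> t \<le> 1 \<and> q = p + t \<cdot> (r - p))"
proof -
  have "q = p + t \<cdot> (r - p) \<longleftrightarrow> (\<forall>i\<in>{1..d}. q i = p i + t * (r i - p i))" for t
    using assms by (auto intro!: points_eqI[of _ d])
  then show ?thesis using assms by (auto simp: Bw_def)
qed

text \<open>The position ratio \<open>t\<close> of \<open>r\<close> on the line \<open>p q\<close> changes to \<open>1 / t\<close> or \<open>1 - t\<close> when the
  points are permuted.  All permutations of three collinear points arise from these two.\<close>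

lemma combination_inverse:
  fixes p q r :: "nat \<Rightarrow> 'a::field"
  assumes "r = p + t \<cdot> (q - p)" "t \<noteq> 0"
  shows "q = p + (1 / t) \<cdot> (r - p)"
  using assms by (auto simp: fun_eq_iff field_simps)

lemma combination_flip:
  fixes p q r :: "nat \<Rightarrow> 'a::field"
  assumes "r = p + t \<cdot> (q - p)"
  shows "r = q + (1 - t) \<cdot> (p - q)"
  using assms by (auto simp: fun_eq_iff algebra_simps)

lemma collinear_iff_Bw:
  fixes p q r :: "'a::linordered_field point"
  assumes "p \<in> points d" "q \<in> points d" "r \<in> points d"
  shows "collinear p q r \<longleftrightarrow> [p, q, r] \<in> Bw d \<or> [q, r, p] \<in> Bw d \<or> [r, p, q] \<in> Bw d"
proof
  assume "collinear p q r"
  then consider "p = q" | t where "r = p + t \<cdot> (q - p)" by (auto simp: collinear_def)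
  then show "[p, q, r] \<in> Bw d \<or> [q, r, p] \<in> Bw d \<or> [r, p, q] \<in> Bw d"
  proof cases
    case 1
    then have "[p, q, r] \<in> Bw d" using assms by (auto simp: Bw_iff intro!: exI[of _ 0])
    then show ?thesis by blast
  next
    case (2 t)
    consider "t > 1" | "0 \<le> t" "t \<le> 1" | "t < 0" by linarith
    then show ?thesis
    proof cases
      case 1
      then have "[p, q, r] \<in> Bw d"
        using combination_inverse[OF 2] assms by (auto simp: Bw_iff intro!: exI[of _ "1 / t"])
      then show ?thesis by blast
    next
      case b: 2
      then have "[q, r, p] \<in> Bw d"
        using combination_flip[OF 2] assms by (auto simp: Bw_iff intro!: exI[of _ "1 - t"])
      then show ?thesis by blast
    next
      case 3
      have "p = r + (1 - 1 / (1 - t)) \<cdot> (q - r)"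
        using combination_flip[OF combination_inverse[OF combination_flip[OF 2]]] 3 by simp
      then have "[r, p, q] \<in> Bw d"
        using assms 3 by (auto simp: Bw_iff field_simps intro!: exI[of _ "1 - 1 / (1 - t)"])
      then show ?thesis by blast
    qed
  qed
next
  assume "[p, q, r] \<in> Bw d \<or> [q, r, p] \<in> Bw d \<or> [r, p, q] \<in> Bw d"
  then consider t where "q = p + t \<cdot> (r - p)" | t where "r = q + t \<cdot> (p - q)"
    | t where "p = r + t \<cdot> (q - r)"
    using assms by (auto simp: Bw_iff)
  then show "collinear p q r"
  proof cases
    case (1 t)
    show ?thesis
    proof (cases "t = 0")
      case True
      with 1 show ?thesis by (simp add: collinear_def)
    next
      case False
      from combination_inverse[OF 1 False] show ?thesis ..
    qed
  next
    case (2 t)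
    from combination_flip[OF 2] show ?thesis ..
  next
    case (3 t)
    note 4 = combination_flip[OF 3]
    show ?thesis
    proof (cases "1 - t = 0")
      case True
      with 4 show ?thesis by (simp add: collinear_def)
    next
      case False
      from combination_flip[OF combination_inverse[OF 4 False]] show ?thesis ..
    qed
  qed
qed

text \<open>A common point \<open>c\<close> of \<open>p s\<close> and \<open>q r\<close> puts the four points into one plane.  With \<open>b\<close> the ratio
  of \<open>c\<close> on \<open>q r\<close> and \<open>k\<close> the ratio of \<open>s\<close> on \<open>p c\<close>, the vector \<open>s - r\<close> has the component
  \<open>k * b - 1\<close> along \<open>r - p\<close>, and unless it is zero the lines \<open>p q\<close> and \<open>r s\<close> meet.\<close>

lemma parallel_if_transversal:
  fixes p q r s :: "'a::linordered_field point"
  assumes pts: "p \<in> points d" "q \<in> points d" "r \<in> points d" "s \<in> points d"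
    and ne: "p \<noteq> q" "r \<noteq> s"
    and disj: "\<And>x. x \<in> points d \<Longrightarrow> collinear p q x \<Longrightarrow> collinear r s x \<Longrightarrow> False"
    and c: "collinear p s c" "collinear q r c"
  shows "parallel p q r s"
proof -
  have "collinear p q p" "collinear p q q" "collinear r s r" "collinear r s s"
    by (auto simp: collinear_def intro: exI[of _ 0] exI[of _ 1])
  with disj pts have "p \<noteq> s" "q \<noteq> r" and nr: "\<not> collinear p q r" by auto
  then obtain a b where a: "c = p + a \<cdot> (s - p)" and b: "c = q + b \<cdot> (r - q)"
    using c unfolding collinear_def by blast
  have "a \<noteq> 0"
  proof
    assume "a = 0"
    with a b have p: "p = q + b \<cdot> (r - q)" by simp
    with ne(1) have "b \<noteq> 0" by auto
    from combination_flip[OF combination_inverse[OF p this]] nr show False by auto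
  qed
  define k where "k = 1 / a"
  have s: "s = p + k \<cdot> (c - p)"
    using combination_inverse[OF a \<open>a \<noteq> 0\<close>] by (simp add: k_def)
  have kb: "k * b = 1"
  proof (rule ccontr)
    assume "k * b \<noteq> 1"
    define x where "x = r + (1 / (1 - k * b)) \<cdot> (s - r)"
    have "x = p + (k * (1 - b) / (1 - k * b)) \<cdot> (q - p)"
      using \<open>k * b \<noteq> 1\<close> by (auto simp: x_def s b fun_eq_iff field_simps)
    then have "collinear p q x" ..
    moreover have "collinear r s x" unfolding x_def by blast
    moreover have "x \<in> points d" using pts by (simp add: x_def)
    ultimately show False using disj by blast
  qed
  have "s - r = (k * (1 - b)) \<cdot> (q - p) + (k * b - 1) \<cdot> (r - p)"
    by (simp add: s b fun_eq_iff algebra_simps)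
  with kb have "s - r = (k * (1 - b)) \<cdot> (q - p)" by simp
  with ne show ?thesis by (auto simp: parallel_def)
qed

lemma parallel_swap: "parallel p q s r \<longleftrightarrow> parallel p q r (s :: nat \<Rightarrow> 'a::field)"
proof -
  have *: "s - r = t \<cdot> (q - p) \<longleftrightarrow> r - s = (- t) \<cdot> (q - p)" for t and r s :: "nat \<Rightarrow> 'a"
    by (auto simp: fun_eq_iff algebra_simps)
  show ?thesis unfolding parallel_def by (metis *)
qed

lemma collinear_swap: "collinear q p r \<longleftrightarrow> collinear p q (r :: nat \<Rightarrow> 'a::field)"
  unfolding collinear_def by (metis combination_flip)

text \<open>That the lines \<open>p q\<close> and \<open>r s\<close> are coplanar is expressed by a common point of two transversals.
  Both pairs of transversals have to be tried, since in a parallelogram those of one pair are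
  parallel.  Degenerate cases such as \<open>p = s\<close>, in which
  \<^const>\<open>collinear\<close> holds trivially, are excluded as the lines then have a common point.\<close>

lemma parallel_iff_collinear:
  fixes p q r s :: "'a::linordered_field point"
  assumes pts: "p \<in> points d" "q \<in> points d" "r \<in> points d" "s \<in> points d"
  shows "parallel p q r s \<longleftrightarrow> \<not> p = q \<and> \<not> r = s \<and>
    (collinear p q r \<and> collinear p q s \<or>
     \<not> (\<exists>x\<in>points d. collinear p q x \<and> collinear r s x) \<and>
     (\<exists>c\<in>points d. collinear p s c \<and> collinear q r c \<or> collinear p r c \<and> collinear q s c))"
    (is "_ \<longleftrightarrow> ?R")
proof
  assume "parallel p q r s"
  then obtain t where ne: "p \<noteq> q" "r \<noteq> s" and t: "s - r = t \<cdot> (q - p)"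
    by (auto simp: parallel_def)
  have s: "s = r + t \<cdot> (q - p)" using t by (metis add.commute diff_add_cancel)
  have col: "collinear p q r \<and> collinear p q s"
    if "x \<in> points d" "collinear p q x" "collinear r s x" for x
  proof -
    from that ne obtain a b where ab: "x = p + a \<cdot> (q - p)" "x = r + b \<cdot> (s - r)"
      unfolding collinear_def by blast
    then have "r = p + (a - b * t) \<cdot> (q - p)"
      using t by (auto simp: fun_eq_iff algebra_simps)
    moreover from this have "s = p + (a - b * t + t) \<cdot> (q - p)"
      unfolding s by (subst \<open>r = _\<close>) (simp add: fun_eq_iff algebra_simps)
    ultimately show ?thesis by blast
  qed
  have "\<exists>c\<in>points d. collinear p s c \<and> collinear q r c \<or> collinear p r c \<and> collinear q s c"
  proof (cases "t = - 1")
    case False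
    then have "1 + t \<noteq> 0" by (simp add: add_eq_0_iff)
    define c where "c = p + (1 / (1 + t)) \<cdot> (s - p)"
    have "c = q + (1 / (1 + t)) \<cdot> (r - q)"
      using \<open>1 + t \<noteq> 0\<close> by (auto simp: c_def s fun_eq_iff field_simps)
    then have "collinear q r c" ..
    moreover have "collinear p s c" unfolding c_def by blast
    moreover have "c \<in> points d" using pts by (simp add: c_def)
    ultimately show ?thesis by blast
  next
    case True
    define c where "c = p + (1 / 2) \<cdot> (r - p)"
    have "c = q + (1 / 2) \<cdot> (s - q)"
      using True by (auto simp: c_def s fun_eq_iff field_simps)
    then have "collinear q s c" ..
    moreover have "collinear p r c" unfolding c_def by blast
    moreover have "c \<in> points d" using pts by (simp add: c_def)
    ultimately show ?thesis by blast
  qed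
  with ne col show ?R by blast
next
  assume R: ?R
  then have ne: "p \<noteq> q" "r \<noteq> s" by auto
  show "parallel p q r s"
  proof (cases "collinear p q r \<and> collinear p q s")
    case True
    then obtain a b where "r = p + a \<cdot> (q - p)" "s = p + b \<cdot> (q - p)"
      using ne by (auto simp: collinear_def)
    then have "s - r = (b - a) \<cdot> (q - p)" by (simp add: fun_eq_iff algebra_simps)
    with ne show ?thesis by (auto simp: parallel_def)
  next
    case False
    with R obtain c where
      disj: "\<And>x. x \<in> points d \<Longrightarrow> collinear p q x \<Longrightarrow> collinear r s x \<Longrightarrow> False" and
      c: "collinear p s c \<and> collinear q r c \<or> collinear p r c \<and> collinear q s c"
      by blast
    from c show ?thesis
    proof
      assume "collinear p s c \<and> collinear q r c"
      with disj show ?thesis by (intro parallel_if_transversal[OF pts ne]) auto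
    next
      assume "collinear p r c \<and> collinear q s c"
      with disj have "parallel p q s r"
        by (intro parallel_if_transversal[OF pts(1,2,4,3) ne(1) ne(2)[symmetric]])
          (auto simp: collinear_swap[of s r])
      then show ?thesis by (simp add: parallel_swap)
    qed
  qed
qed

lemma parallelogram_iff_parallel:
  fixes p q r s :: "'a::linordered_field point"
  shows "parallelogram p q r s \<longleftrightarrow> \<not> collinear p q r \<and> parallel p q r s \<and> parallel p r q s"
proof
  assume *: "parallelogram p q r s"
  then have nc: "\<not> collinear p q r" and eq: "q - p = s - r" by (auto simp: parallelogram_def)
  from nc have "p \<noteq> q" by (auto simp: collinear_def)
  from nc have "p \<noteq> r" by (auto simp: collinear_def dest: spec[of _ 0])
  have eq': "s - q = r - p" using eq by (metis add_diff_cancel_left' add_diff_eq diff_add_eq diff_diff_eq2)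
  have "r \<noteq> s" using eq \<open>p \<noteq> q\<close> by auto
  have "q \<noteq> s" using eq' \<open>p \<noteq> r\<close> by auto
  have "s - r = 1 \<cdot> (q - p)" "s - q = 1 \<cdot> (r - p)" using eq eq' by simp_all
  with nc \<open>p \<noteq> q\<close> \<open>p \<noteq> r\<close> \<open>r \<noteq> s\<close> \<open>q \<noteq> s\<close>
  show "\<not> collinear p q r \<and> parallel p q r s \<and> parallel p r q s"
    unfolding parallel_def by blast
next
  assume *: "\<not> collinear p q r \<and> parallel p q r s \<and> parallel p r q s"
  then obtain a b where a: "s - r = a \<cdot> (q - p)" and b: "s - q = b \<cdot> (r - p)"
    by (auto simp: parallel_def)
  have e: "(1 - a) \<cdot> (q - p) = (1 - b) \<cdot> (r - p)"
  proof
    fix i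
    have "s i - r i = a * (q i - p i)" "s i - q i = b * (r i - p i)"
      using fun_cong[OF a, of i] fun_cong[OF b, of i] by simp_all
    then show "((1 - a) \<cdot> (q - p)) i = ((1 - b) \<cdot> (r - p)) i"
      by (simp add: algebra_simps)
  qed
  have "b = 1"
  proof (rule ccontr)
    assume "b \<noteq> 1"
    then have "r = p + ((1 - a) / (1 - b)) \<cdot> (q - p)"
    proof -
      have "r i = p i + (1 - a) / (1 - b) * (q i - p i)" for i
        using fun_cong[OF e, of i] \<open>b \<noteq> 1\<close> by (simp add: field_simps)
      then show ?thesis by (simp add: fun_eq_iff)
    qed
    with * show False by auto
  qed
  with e a have "(1 - a) \<cdot> (q - p) = 0" by simp
  moreover have "q \<noteq> p" using * by (auto simp: collinear_def)
  ultimately have "a = 1" by (auto simp: fun_eq_iff)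
  with a have "q - p = s - r" by simp
  with * show "parallelogram p q r s" by (simp add: parallelogram_def)
qed

text \<open>The parallelogram with vertices \<open>p\<close>, \<open>q\<close>, \<open>r\<close>, \<open>s\<close> degenerates if these points are collinear.
  A third segment that lies on neither line repairs this; it exists because the dimension is at
  least two.\<close>

lemma translation_iff_parallelogram:
  fixes p q r s :: "'a::linordered_field point"
  assumes d: "d \<ge> 2" and pts: "p \<in> points d" "q \<in> points d" "r \<in> points d" "s \<in> points d"
  shows "q - p = s - r \<longleftrightarrow> p = q \<and> r = s \<or>
    (\<exists>x\<in>points d. \<exists>y\<in>points d. parallelogram p q x y \<and> parallelogram r s x y)"
proof
  assume eq: "q - p = s - r"
  show "p = q \<and> r = s \<or>
    (\<exists>x\<in>points d. \<exists>y\<in>points d. parallelogram p q x y \<and> parallelogram r s x y)"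
  proof (cases "p = q")
    case True
    then have "s - r = 0" using eq by simp
    with True show ?thesis by simp
  next
    case False
    define v where "v = q - p"
    have v: "v \<in> vecs d" "v \<noteq> 0" using False pts by (auto simp: v_def)
    have qv: "q = p + v" by (simp add: v_def)
    have sv: "s = r + v" unfolding v_def eq by simp
    obtain w where w: "w \<in> vecs d" and indep: "\<And>a. w \<noteq> a \<cdot> v"
    proof -
      define e where "e = (\<lambda>k i::nat. if i = k then 1 else 0 :: 'a)"
      have "e 1 \<in> vecs d" "e 2 \<in> vecs d" using d by (auto simp: e_def vecs_def)
      moreover have "\<not> (\<exists>a b. e 1 = a \<cdot> v \<and> e 2 = b \<cdot> v)"
      proof clarify
        fix a b assume "e 1 = a \<cdot> v" "e 2 = b \<cdot> v"
        then have "e 1 1 = a * v 1" "e 1 2 = a * v 2" "e 2 1 = b * v 1" "e 2 2 = b * v 2"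
          by simp_all
        then show False by (auto simp: e_def)
      qed
      ultimately show ?thesis using that by blast
    qed
    have "\<not> collinear p q (p + a \<cdot> w)" if "a \<noteq> 0" for a
    proof
      assume "collinear p q (p + a \<cdot> w)"
      then obtain t where "p + a \<cdot> w = p + t \<cdot> v" using False by (auto simp: collinear_def qv)
      then have "w = (t / a) \<cdot> v" using that by (auto simp: fun_eq_iff field_simps)
      with indep show False by blast
    qed
    then have 1: "\<not> collinear p q (p + w)" "\<not> collinear p q (p + (- 1) \<cdot> w)"
      by (metis scale_1_left zero_neq_one, simp)
    \<comment> \<open>Of two points that lie on opposite sides of \<open>p q\<close>, at most one is on the line \<open>r s\<close>.\<close>
    have "\<not> (collinear r s (p + w) \<and> collinear r s (p + (- 1) \<cdot> w))"
    proof
      assume "collinear r s (p + w) \<and> collinear r s (p + (- 1) \<cdot> w)"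
      moreover have "r \<noteq> s" using v(2) sv by auto
      ultimately obtain a b where "p + w = r + a \<cdot> v" "p + (- 1) \<cdot> w = r + b \<cdot> v"
        by (auto simp: collinear_def sv)
      then have "p i + w i = r i + a * v i" "p i - w i = r i + b * v i" for i
        by (auto simp: fun_eq_iff)
      from this(1) this(2) have "2 * w i = (a - b) * v i" for i
      proof -
        have "2 * w i = (p i + w i) - (p i - w i)" by simp
        also have "\<dots> = (r i + a * v i) - (r i + b * v i)"
          using \<open>\<And>i. p i + w i = r i + a * v i\<close> \<open>\<And>i. p i - w i = r i + b * v i\<close> by simp
        finally show ?thesis by (simp add: algebra_simps)
      qed
      then have "w = ((a - b) / 2) \<cdot> v" by (auto simp: fun_eq_iff field_simps)
      with indep show False by blast
    qed
    with 1 obtain x where x: "x \<in> points d" "\<not> collinear p q x" "\<not> collinear r s x"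
      using w pts by (metis points_add vecs_closed(3))
    then have "parallelogram p q x (x + v)" "parallelogram r s x (x + v)"
      by (simp_all add: parallelogram_def qv sv)
    with x v show ?thesis by (meson points_add)
  qed
qed (auto simp: parallelogram_def)

section \<open>Minkowski orthogonality from lightlikeness\<close>

text \<open>Written \<open>B(u, v)\<close> in the explanations below.\<close>

definition mform :: "nat \<Rightarrow> (nat \<Rightarrow> 'a::field) \<Rightarrow> (nat \<Rightarrow> 'a) \<Rightarrow> 'a" where
  "mform d u v = u 1 * v 1 - (\<Sum>i=2..d. u i * v i)"

definition lightlike where
  "lightlike d p q \<longleftrightarrow> mform d (q - p) (q - p) = 0"

definition orthogonal where
  "orthogonal d p q r s \<longleftrightarrow> mform d (q - p) (s - r) = 0"

lemma mform_commute: "mform d u v = mform d v u"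
  by (simp add: mform_def mult.commute)

lemma mform_bilinear [simp]:
  "mform d (u + u') v = mform d u v + mform d u' v"
  "mform d v (u + u') = mform d v u + mform d v u'"
  "mform d (u - u') v = mform d u v - mform d u' v"
  "mform d v (u - u') = mform d v u - mform d v u'"
  "mform d (c \<cdot> u) v = c * mform d u v"
  "mform d v (c \<cdot> u) = c * mform d v u"
  by (simp_all add: mform_def algebra_simps sum.distrib sum_subtractf sum_distrib_left)

lemma mform_zero [simp]: "mform d 0 v = 0" "mform d v 0 = 0"
  by (simp_all add: mform_def)

lemma mdist2_eq: "mdist2 d p q = mform d (q - p) (q - p)"
  by (simp add: mdist2_def mform_def power2_eq_square algebra_simps)

lemma Light_iff:
  "p \<in> points d \<Longrightarrow> q \<in> points d \<Longrightarrow> [p, q] \<in> Light d \<longleftrightarrow> lightlike d p q"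
  using mdist2_eq[of d p q] by (auto simp: Light_def lightlike_def mdist2_def)

text \<open>The equality case of the Cauchy-Schwarz inequality.  Let \<open>a\<close> and \<open>b\<close> be the time components of
  \<open>u\<close> and \<open>v\<close>.  The assumptions determine all inner products of the space parts, and by
  them the squared length of \<open>b u - a v\<close> is zero.\<close>

lemma orthogonal_null_vectors_proportional:
  fixes u v :: "nat \<Rightarrow> 'a::linordered_field"
  assumes vecs: "u \<in> vecs d" "v \<in> vecs d" and "u \<noteq> 0"
    and form: "mform d u u = 0" "mform d v v = 0" "mform d u v = 0"
  shows "\<exists>t. v = t \<cdot> u"
proof -
  define a b where "a = u 1" and "b = v 1"
  have sums: "(\<Sum>i=2..d. u i * u i) = a * a" "(\<Sum>i=2..d. v i * v i) = b * b"
    "(\<Sum>i=2..d. u i * v i) = a * b"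
    using form by (simp_all add: mform_def a_def b_def)
  have zero: "\<forall>i\<in>{2..d}. f i = 0" if "(\<Sum>i=2..d. (f i)\<^sup>2) = 0" for f :: "nat \<Rightarrow> 'a"
    using that by (subst (asm) sum_nonneg_eq_0_iff) auto
  have outside: "w i = 0" if "w \<in> vecs d" "i \<noteq> 1" "i \<notin> {2..d}" for w :: "nat \<Rightarrow> 'a" and i
    using that by (auto simp: vecs_def)
  have "a \<noteq> 0"
  proof
    assume "a = 0"
    then have "\<forall>i\<in>{2..d}. u i = 0"
      using sums(1) by (intro zero) (simp add: power2_eq_square)
    with \<open>a = 0\<close> have "u i = 0" for i
      using outside[OF vecs(1), of i] by (cases "i = 1"; cases "i \<in> {2..d}") (simp_all add: a_def)
    then have "u = 0" by (simp add: fun_eq_iff)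
    with \<open>u \<noteq> 0\<close> show False ..
  qed
  have "(\<Sum>i=2..d. (b * u i - a * v i)\<^sup>2) =
      b * b * (\<Sum>i=2..d. u i * u i) + a * a * (\<Sum>i=2..d. v i * v i)
      - 2 * a * b * (\<Sum>i=2..d. u i * v i)"
    unfolding sum_distrib_left sum.distrib[symmetric] sum_subtractf[symmetric]
    by (intro sum.cong) (auto simp: power2_eq_square algebra_simps)
  also have "\<dots> = 0" unfolding sums by (simp add: algebra_simps)
  finally have "\<forall>i\<in>{2..d}. b * u i - a * v i = 0" by (rule zero)
  then have "a * v i = b * u i" for i
    using outside[OF vecs(1), of i] outside[OF vecs(2), of i]
    by (cases "i = 1"; cases "i \<in> {2..d}") (simp_all add: a_def b_def)
  then have "v = (b / a) \<cdot> u"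
    using \<open>a \<noteq> 0\<close> by (simp add: fun_eq_iff nonzero_eq_divide_eq mult.commute)
  then show ?thesis ..
qed

text \<open>The null vectors \<open>(1, 0, \<dots>, \<plusminus>1, \<dots>, 0)\<close> span the space, so that a vector orthogonal to all of them
  would be zero.\<close>

lemma null_vector_not_orthogonal:
  fixes u :: "nat \<Rightarrow> 'a::linordered_field"
  assumes d: "d \<ge> 2" and u: "mform d u u \<noteq> 0"
  obtains n where "n \<in> vecs d" "mform d n n = 0" "mform d u n \<noteq> 0"
proof -
  define n where "n = (\<lambda>c j i::nat. if i = 1 then 1 else if i = j then c else 0 :: 'a)"
  have sum_j: "(\<Sum>i=2..d. f i * n c j i) = f j * c" if "j \<in> {2..d}" for f c j
  proof -
    have "(\<Sum>i=2..d. f i * n c j i) = (\<Sum>i=2..d. if i = j then f i * c else 0)"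
      using that by (intro sum.cong) (auto simp: n_def)
    then show ?thesis using that by simp
  qed
  have form: "mform d f (n c j) = f 1 - f j * c" if "j \<in> {2..d}" for f c j
    using sum_j[OF that] by (simp add: mform_def n_def)
  note witness = that
  show thesis
  proof (rule ccontr)
    assume no: "\<not> thesis"
    have orth: "mform d u (n c j) = 0" if "c * c = 1" "j \<in> {2..d}" for c j
    proof (rule ccontr)
      assume "mform d u (n c j) \<noteq> 0"
      moreover have "n c j \<in> vecs d" using that d by (auto simp: vecs_def n_def)
      moreover have "mform d (n c j) (n c j) = 0"
        using that by (subst form) (auto simp: n_def)
      ultimately show False using no witness by blast
    qed
    have *: "u 1 - u j = 0" "u 1 + u j = 0" if "j \<in> {2..d}" for j
      using orth[of 1 j] orth[of "- 1" j] that by (simp_all add: form)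
    then have "u j = 0" if "j \<in> {2..d}" for j
      using that by (metis add_eq_0_iff eq_iff_diff_eq_0 equal_neg_zero)
    moreover have "u 1 = 0" using *[of 2] d calculation[of 2] by simp
    ultimately have "mform d u u = 0" by (simp add: mform_def)
    with u show False ..
  qed
qed

text \<open>On the line \<open>q + t v\<close> through the point \<open>q\<close> of the light cone of \<open>p\<close>, the form is
  \<open>t (2 B(q - p, v) + t B(v, v))\<close>.  So if \<open>v\<close> is not null, the line meets the cone only in \<open>q\<close>
  exactly when \<open>v\<close> is orthogonal to \<open>q - p\<close>: tangency to the cone defines orthogonality.  Null
  vectors \<open>v\<close> orthogonal to \<open>q - p\<close> are its multiples.\<close>

lemma orthogonal_to_lightlike_iff:
  fixes p q r :: "'a::linordered_field point"
  assumes pts: "p \<in> points d" "q \<in> points d" "r \<in> points d"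
    and pq: "lightlike d p q" "p \<noteq> q"
  shows "orthogonal d p q p r \<longleftrightarrow> collinear p q r \<or>
    \<not> lightlike d q r \<and> (\<forall>x\<in>points d. collinear q r x \<and> lightlike d p x \<longrightarrow> x = q)"
proof -
  define u v where "u = q - p" and "v = r - q"
  have q: "q = p + u" and r: "r = q + v" by (simp_all add: u_def v_def)
  have "u \<noteq> 0" "u \<in> vecs d" "v \<in> vecs d" using pq pts by (auto simp: u_def v_def)
  have null: "mform d u u = 0" using pq by (simp add: lightlike_def u_def)
  have orth: "orthogonal d p q p r \<longleftrightarrow> mform d u v = 0"
    using null by (simp add: orthogonal_def r q algebra_simps)
  have light_qr: "lightlike d q r \<longleftrightarrow> mform d v v = 0"
    by (simp add: lightlike_def r)
  have light_line: "lightlike d p (q + t \<cdot> v) \<longleftrightarrow> t * (2 * mform d u v + t * mform d v v) = 0" for t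
  proof -
    have "q + t \<cdot> v - p = u + t \<cdot> v" by (simp add: u_def algebra_simps)
    then have "mform d (q + t \<cdot> v - p) (q + t \<cdot> v - p) = t * (2 * mform d u v + t * mform d v v)"
      using null mform_commute[of d v u] by (simp add: algebra_simps)
    then show ?thesis by (simp add: lightlike_def)
  qed
  show ?thesis
  proof
    assume "orthogonal d p q p r"
    then have uv: "mform d u v = 0" by (simp add: orth)
    show "collinear p q r \<or>
      \<not> lightlike d q r \<and> (\<forall>x\<in>points d. collinear q r x \<and> lightlike d p x \<longrightarrow> x = q)"
    proof (cases "mform d v v = 0")
      case True
      then obtain t where "v = t \<cdot> u"
        using orthogonal_null_vectors_proportional \<open>u \<noteq> 0\<close> \<open>u \<in> vecs d\<close> \<open>v \<in> vecs d\<close> null uv by blast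
      then have "r = p + (1 + t) \<cdot> (q - p)" by (simp add: r q fun_eq_iff algebra_simps)
      then show ?thesis by blast
    next
      case False
      have "x = q" if "collinear q r x" "lightlike d p x" for x
      proof -
        have "v \<noteq> 0" using False by auto
        with that(1) obtain t where x: "x = q + t \<cdot> v" by (auto simp: collinear_def r)
        with that(2) light_line[of t] False uv have "t = 0" by simp
        with x show ?thesis by simp
      qed
      with False show ?thesis by (auto simp: light_qr)
    qed
  next
    assume R: "collinear p q r \<or>
      \<not> lightlike d q r \<and> (\<forall>x\<in>points d. collinear q r x \<and> lightlike d p x \<longrightarrow> x = q)"
    show "orthogonal d p q p r"
    proof (cases "collinear p q r")
      case True
      then obtain t where "r = p + t \<cdot> u" using pq by (auto simp: collinear_def u_def)
      then show ?thesis using null by (simp add: orthogonal_def q)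
    next
      case False
      with R have vv: "mform d v v \<noteq> 0"
        and only: "\<And>x. x \<in> points d \<Longrightarrow> collinear q r x \<Longrightarrow> lightlike d p x \<Longrightarrow> x = q"
        by (auto simp: light_qr)
      \<comment> \<open>The second zero of the form on the line, besides the one at \<open>q\<close>.\<close>
      define t where "t = - 2 * mform d u v / mform d v v"
      have "q + t \<cdot> v = q"
      proof (rule only)
        show "q + t \<cdot> v \<in> points d" using pts \<open>v \<in> vecs d\<close> by simp
        show "collinear q r (q + t \<cdot> v)" unfolding v_def by blast
        show "lightlike d p (q + t \<cdot> v)" unfolding light_line using vv by (simp add: t_def)
      qed
      then have "t \<cdot> v = 0" by simp
      moreover have "v \<noteq> 0" using vv by auto
      ultimately have "t = 0" by (auto simp: fun_eq_iff)
      then show ?thesis using vv by (simp add: t_def orth)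
    qed
  qed
qed

text \<open>A non-null vector \<open>u = q - p\<close> is the diagonal \<open>a + b\<close> of a parallelogram with null sides.  The
  other diagonal \<open>b - a\<close> is orthogonal to \<open>u\<close>, and the orthogonal complement of \<open>u\<close> consists of
  the sums of a multiple of \<open>b - a\<close> and a vector orthogonal to both \<open>a\<close> and \<open>b\<close>.  This reduces
  orthogonality to \<open>u\<close> to orthogonality to null vectors.\<close>

lemma orthogonal_to_nonlightlike_iff:
  fixes p q r :: "'a::linordered_field point"
  assumes d: "d \<ge> 2" and pts: "p \<in> points d" "q \<in> points d" "r \<in> points d"
    and pq: "\<not> lightlike d p q"
  shows "orthogonal d p q p r \<longleftrightarrow>
    (\<exists>x\<in>points d. \<exists>y\<in>points d. \<exists>z\<in>points d. parallelogram p x y q \<and>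
       (lightlike d p x \<and> orthogonal d p x p z) \<and> (lightlike d p y \<and> orthogonal d p y p z) \<and>
       (z = r \<or> parallel x y z r))"
    (is "_ \<longleftrightarrow> ?R")
proof
  define u v where "u = q - p" and "v = r - p"
  have vecs: "u \<in> vecs d" "v \<in> vecs d" using pts by (simp_all add: u_def v_def)
  have uu: "mform d u u \<noteq> 0" using pq by (simp add: lightlike_def u_def)
  assume "orthogonal d p q p r"
  then have uv: "mform d u v = 0" by (simp add: orthogonal_def u_def v_def)
  from null_vector_not_orthogonal[OF d uu]
  obtain n where n: "n \<in> vecs d" "mform d n n = 0" "mform d u n \<noteq> 0" .
  \<comment> \<open>This multiple of \<open>n\<close> is the one for which the other side \<open>u - a\<close> is null as well.\<close>
  define a where "a = (mform d u u / (2 * mform d u n)) \<cdot> n"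
  define b where "b = u - a"
  have ab_vecs: "a \<in> vecs d" "b \<in> vecs d" using n vecs by (simp_all add: a_def b_def)
  have aa: "mform d a a = 0" using n by (simp add: a_def)
  have ua: "mform d u a = mform d u u / 2" using n by (simp add: a_def)
  have bb: "mform d b b = 0" and ab: "mform d a b = mform d u u / 2"
    using aa ua mform_commute[of d a u] by (simp_all add: b_def)
  have ba: "mform d b a = mform d u u / 2" using ab by (simp add: mform_commute)
  \<comment> \<open>The choice of \<open>t\<close> makes \<open>w\<close> orthogonal to \<open>a\<close>; orthogonality to \<open>b\<close> then follows, since \<open>v\<close> is orthogonal to \<open>a + b\<close>.\<close>
  define t where "t = mform d a v / mform d a b"
  define w where "w = v - t \<cdot> (b - a)"
  have tab: "t * mform d a b = mform d a v" using ab uu by (simp add: t_def)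
  then have aw: "mform d a w = 0" using aa by (simp add: w_def)
  have "mform d a v + mform d b v = 0" using uv by (simp add: b_def)
  moreover have "mform d b w = mform d b v + t * mform d a b"
    using bb mform_commute[of d b a] by (simp add: w_def)
  ultimately have bw: "mform d b w = 0" unfolding tab by (simp add: add.commute)
  have nc: "\<not> collinear p (p + a) (p + b)"
  proof
    assume "collinear p (p + a) (p + b)"
    then consider "a = 0" | s where "b = s \<cdot> a" by (auto simp: collinear_def)
    then have "mform d a b = 0" using aa by cases auto
    with ab uu show False by simp
  qed
  have "q - (p + b) = a" by (simp add: b_def u_def fun_eq_iff)
  with nc have "parallelogram p (p + a) (p + b) q" by (simp add: parallelogram_def)
  moreover have "p + w = r \<or> parallel (p + a) (p + b) (p + w) r"
  proof (cases "p + w = r")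
    case False
    moreover have "r - (p + w) = t \<cdot> ((p + b) - (p + a))"
      by (simp add: w_def v_def fun_eq_iff)
    moreover have "p + a \<noteq> p + b" using aa ab uu by auto
    ultimately show ?thesis unfolding parallel_def by blast
  qed simp
  moreover have "p + a \<in> points d" "p + b \<in> points d" "p + w \<in> points d"
    using pts ab_vecs vecs by (simp_all add: w_def)
  ultimately show ?R
    using aa bb aw bw
    by (intro bexI[of _ "p + a"] bexI[of _ "p + b"] bexI[of _ "p + w"])
      (auto simp: lightlike_def orthogonal_def)
next
  assume ?R
  then obtain x y z where *: "parallelogram p x y q" "lightlike d p x" "orthogonal d p x p z"
    "lightlike d p y" "orthogonal d p y p z" "z = r \<or> parallel x y z r"
    by blast
  define a b w where "a = x - p" and "b = y - p" and "w = z - p"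
  have "q - y = a" using *(1) by (simp add: parallelogram_def a_def)
  then have q: "q - p = a + b" by (simp add: b_def fun_eq_iff algebra_simps)
  obtain t where t: "r - z = t \<cdot> (y - x)" using *(6) by (metis parallel_def cancel_comm_monoid_add_class.diff_cancel scale_0_left)
  have "r - p = w + (r - z)" by (simp add: w_def)
  also have "r - z = t \<cdot> (b - a)" unfolding t by (simp add: a_def b_def)
  finally have r: "r - p = w + t \<cdot> (b - a)" .
  have "mform d a a = 0" "mform d b b = 0" "mform d a w = 0" "mform d b w = 0"
    using * by (simp_all add: lightlike_def orthogonal_def a_def b_def w_def)
  then show "orthogonal d p q p r"
    using mform_commute[of d b a] unfolding orthogonal_def q r by simp
qed

lemma orthogonal_iff_translate:
  assumes "p \<in> points d" "q \<in> points d" "r \<in> points d" "s \<in> points d"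
  shows "orthogonal d p q r s \<longleftrightarrow>
    (\<exists>x\<in>points d. s - r = x - p \<and> orthogonal d p q p x)"
proof
  assume "orthogonal d p q r s"
  then show "\<exists>x\<in>points d. s - r = x - p \<and> orthogonal d p q p x"
    using assms by (intro bexI[of _ "p + (s - r)"]) (auto simp: orthogonal_def)
next
  assume "\<exists>x\<in>points d. s - r = x - p \<and> orthogonal d p q p x"
  then obtain x where "s - r = x - p" "orthogonal d p q p x" by blast
  then show "orthogonal d p q r s" by (simp only: orthogonal_def)
qed

text \<open>After a translation the two segments start at \<open>p\<close>.  Then, for the vectors \<open>u\<close> and \<open>v\<close> of the
  segments, \<open>B(u, u) = B(v, v)\<close> means that \<open>v - u\<close> and \<open>v + u\<close> are orthogonal.\<close>

lemma Cong_mu_iff: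
  fixes p q r s :: "'a::linordered_field point"
  assumes pts: "p \<in> points d" "q \<in> points d" "r \<in> points d" "s \<in> points d"
  shows "[p, q, r, s] \<in> Cong_mu d \<longleftrightarrow>
    (\<exists>x\<in>points d. s - r = x - p \<and> (\<exists>y\<in>points d. q - p = y - x \<and> orthogonal d q x p y))"
proof -
  define u v where "u = q - p" and "v = s - r"
  have vecs: "u \<in> vecs d" "v \<in> vecs d" using pts by (simp_all add: u_def v_def)
  have orth: "orthogonal d q (p + v) p (p + v + u) \<longleftrightarrow> mform d u u = mform d v v"
  proof -
    have "(p + v) - q = v - u" "(p + v + u) - p = v + u" by (simp_all add: u_def fun_eq_iff)
    then have "orthogonal d q (p + v) p (p + v + u) \<longleftrightarrow> mform d (v - u) (v + u) = 0"
      by (simp only: orthogonal_def)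
    then show ?thesis using mform_commute[of d u v] by auto
  qed
  have "v = x - p \<longleftrightarrow> x = p + v" "u = y - x \<longleftrightarrow> y = x + u" for x y
    by (auto simp: fun_eq_iff algebra_simps)
  then have "(\<exists>x\<in>points d. v = x - p \<and> (\<exists>y\<in>points d. u = y - x \<and> orthogonal d q x p y)) \<longleftrightarrow>
      mform d u u = mform d v v"
    using pts vecs orth by auto
  then show ?thesis
    using pts by (simp add: Cong_mu_def mdist2_eq u_def v_def)
qed

section \<open>Rest and Euclidean congruence in late classical spacetime\<close>

lemma Simul_iff: "p \<in> points d \<Longrightarrow> q \<in> points d \<Longrightarrow> [p, q] \<in> Simul d \<longleftrightarrow> p 1 = q 1"
  by (simp add: Simul_def)

lemma Cong_S_iff:
  "p \<in> points d \<Longrightarrow> q \<in> points d \<Longrightarrow> r \<in> points d \<Longrightarrow> s \<in> points d \<Longrightarrow>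
    [p, q, r, s] \<in> Cong_S d \<longleftrightarrow> dist2 d p q = dist2 d r s \<and> p 1 = q 1 \<and> r 1 = s 1"
  by (simp add: Cong_S_def Cong_def Simul_def)

lemma sum_head:
  fixes f :: "nat \<Rightarrow> 'a::comm_monoid_add"
  shows "d \<ge> 1 \<Longrightarrow> (\<Sum>i=1..d. f i) = f 1 + (\<Sum>i=2..d. f i)"
  by (simp add: sum.atLeast_Suc_atMost numeral_2_eq_2)

text \<open>Let \<open>q\<close> not be simultaneous with \<open>p\<close>.  The light cone of \<open>p\<close> cuts the
  hyperplane of events simultaneous with \<open>q\<close> in a sphere, whose centre is the point of this hyperplane that is at rest relative to \<open>p\<close>.  So \<open>q\<close> is that point
  iff it has equal distances to all points of the sphere.  Points of the sphere exist over
  every field: the radius \<open>\<bar>p 1 - q 1\<bar>\<close> can be laid off along each space axis in both directions,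
  and equidistance from these two points fixes one coordinate of \<open>q\<close>.\<close>

lemma Rest_iff_sphere_centre:
  fixes p q :: "'a::linordered_field point"
  assumes d: "d \<ge> 2" and pts: "p \<in> points d" "q \<in> points d"
  shows "[p, q] \<in> Rest d \<longleftrightarrow> p = q \<or> [p, q] \<notin> Simul d \<and>
    (\<forall>x\<in>points d. \<forall>y\<in>points d. ([x, q] \<in> Simul d \<and> [y, q] \<in> Simul d) \<and>
       [p, x] \<in> Light d \<and> [p, y] \<in> Light d \<longrightarrow> [q, x, q, y] \<in> Cong_S d)"
    (is "_ \<longleftrightarrow> _ \<or> ?R")
proof
  assume "[p, q] \<in> Rest d"
  then have rest: "p i = q i" if "i \<in> {2..d}" for i using that by (auto simp: Rest_def)
  have "?R" if "p \<noteq> q"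
  proof
    show "[p, q] \<notin> Simul d"
    proof
      assume "[p, q] \<in> Simul d"
      then have "p 1 = q 1" by (simp add: Simul_iff pts)
      have "p = q"
      proof (rule points_eqI[OF pts])
        fix i assume "i \<in> {1..d}"
        then have "i = 1 \<or> i \<in> {2..d}" by auto
        then show "p i = q i" using \<open>p 1 = q 1\<close> rest by blast
      qed
      with that show False ..
    qed
    have "dist2 d q x = (p 1 - q 1)\<^sup>2"
      if "x \<in> points d" "[x, q] \<in> Simul d" "[p, x] \<in> Light d" for x
    proof -
      have x: "x 1 = q 1" "(p 1 - x 1)\<^sup>2 = (\<Sum>i=2..d. (p i - x i)\<^sup>2)"
        using that pts by (auto simp: Simul_def Light_def)
      have "dist2 d q x = (\<Sum>i=2..d. (q i - x i)\<^sup>2)"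
        unfolding dist2_def using d x(1) by (subst sum_head) simp_all
      also have "\<dots> = (\<Sum>i=2..d. (p i - x i)\<^sup>2)" by (intro sum.cong) (auto simp: rest)
      finally show ?thesis using x by simp
    qed
    then show "\<forall>x\<in>points d. \<forall>y\<in>points d. ([x, q] \<in> Simul d \<and> [y, q] \<in> Simul d) \<and>
       [p, x] \<in> Light d \<and> [p, y] \<in> Light d \<longrightarrow> [q, x, q, y] \<in> Cong_S d"
      using pts by (auto simp: Cong_S_iff Simul_iff)
  qed
  then show "p = q \<or> ?R" by blast
next
  assume R: "p = q \<or> ?R"
  show "[p, q] \<in> Rest d"
  proof (cases "p = q")
    case True
    then show ?thesis using pts by (auto simp: Rest_def)
  next
    case False
    define a where "a = p 1 - q 1"
    from False R have "a \<noteq> 0" using pts by (auto simp: Simul_iff a_def)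
    \<comment> \<open>For \<open>c = a\<close> and \<open>c = - a\<close> these are the two points of the sphere on the axis \<open>j\<close>.\<close>
    define x where "x = (\<lambda>c j::nat. p(1 := q 1, j := p j + c))"
    have "p j = q j" if j: "j \<in> {2..d}" for j
    proof -
      have x: "x c j \<in> points d" "[x c j, q] \<in> Simul d" for c
      proof -
        show "x c j \<in> points d" using pts j by (auto simp: points_def PiE_def extensional_def x_def)
        then show "[x c j, q] \<in> Simul d" using pts j by (simp add: Simul_iff x_def)
      qed
      have light: "[p, x c j] \<in> Light d" if "c\<^sup>2 = a\<^sup>2" for c
      proof -
        have "(\<Sum>i=2..d. (p i - x c j i)\<^sup>2) = (\<Sum>i=2..d. if i = j then c\<^sup>2 else 0)"
          by (intro sum.cong) (auto simp: x_def)
        also have "\<dots> = c\<^sup>2" using j by simp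
        finally show ?thesis
          using that x(1)[of c] pts j by (auto simp: Light_def x_def a_def)
      qed
      have "[q, x a j, q, x (- a) j] \<in> Cong_S d"
        using R False x light[of a] light[of "- a"] by auto
      then have "dist2 d q (x a j) = dist2 d q (x (- a) j)"
        using pts x(1) by (simp add: Cong_S_iff)
      moreover have "dist2 d q (x c j) =
          (q j - (p j + c))\<^sup>2 + (\<Sum>i\<in>{1..d} - {j}. (q i - (p(1 := q 1)) i)\<^sup>2)" for c
      proof -
        have "dist2 d q (x c j) = (q j - x c j j)\<^sup>2 + (\<Sum>i\<in>{1..d} - {j}. (q i - x c j i)\<^sup>2)"
          unfolding dist2_def using j by (intro sum.remove) auto
        also have "(\<Sum>i\<in>{1..d} - {j}. (q i - x c j i)\<^sup>2) =
            (\<Sum>i\<in>{1..d} - {j}. (q i - (p(1 := q 1)) i)\<^sup>2)"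
          by (intro sum.cong) (auto simp: x_def)
        also have "x c j j = p j + c" by (simp add: x_def)
        finally show ?thesis .
      qed
      ultimately have "(q j - (p j + a))\<^sup>2 = (q j - (p j + - a))\<^sup>2" by simp
      then have "a * (q j - p j) = 0" by (auto simp: power2_eq_square algebra_simps)
      with \<open>a \<noteq> 0\<close> show ?thesis by auto
    qed
    then show ?thesis using pts by (auto simp: Rest_def)
  qed
qed

definition eform :: "nat \<Rightarrow> (nat \<Rightarrow> 'a::field) \<Rightarrow> (nat \<Rightarrow> 'a) \<Rightarrow> 'a" where
  "eform d u v = (\<Sum>i=1..d. u i * v i)"

lemma eform_commute: "eform d u v = eform d v u"
  by (simp add: eform_def mult.commute)

lemma eform_bilinear [simp]:
  "eform d (u + u') v = eform d u v + eform d u' v"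
  "eform d v (u + u') = eform d v u + eform d v u'"
  "eform d (u - u') v = eform d u v - eform d u' v"
  "eform d v (u - u') = eform d v u - eform d v u'"
  by (simp_all add: eform_def algebra_simps sum.distrib sum_subtractf)

lemma dist2_eq: "dist2 d p q = eform d (q - p) (q - p)"
  by (simp add: dist2_def eform_def power2_eq_square algebra_simps)

lemma mform_time_reflection:
  "d \<ge> 1 \<Longrightarrow> mform d u (v(1 := - v 1)) = - eform d u v"
  unfolding mform_def eform_def by (subst sum_head) simp_all

text \<open>As for \<open>Cong_mu_iff\<close>, equal lengths mean that the sum and the difference of two vectors are
  orthogonal, now in the Euclidean sense.  Reversing the time component of one of the vectors turns
  Euclidean into Minkowski orthogonality.  The reversal is the reflection of \<open>y\<close> in the hyperplane
  of events simultaneous with \<open>p\<close>, where \<open>m\<close> is the foot of \<open>y\<close> and \<open>z\<close> its mirror image.\<close>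

lemma Cong_iff:
  fixes p q r s :: "'a::linordered_field point"
  assumes d: "d \<ge> 2"
    and pts: "p \<in> points d" "q \<in> points d" "r \<in> points d" "s \<in> points d"
  shows "[p, q, r, s] \<in> Cong d \<longleftrightarrow>
    (\<exists>x\<in>points d. s - r = x - p \<and> (\<exists>y\<in>points d. q - p = y - x \<and>
       (\<exists>m\<in>points d. [m, p] \<in> Simul d \<and> [m, y] \<in> Rest d \<and>
          (\<exists>z\<in>points d. m - y = z - m \<and> orthogonal d q x p z))))"
proof -
  define u v where "u = q - p" and "v = s - r"
  have vecs: "u \<in> vecs d" "v \<in> vecs d" using pts by (simp_all add: u_def v_def)
  have reflect: "(\<exists>m\<in>points d. [m, p] \<in> Simul d \<and> [m, y] \<in> Rest d \<and>
      (\<exists>z\<in>points d. m - y = z - m \<and> orthogonal d q x p z)) \<longleftrightarrow> eform d (x - q) (y - p) = 0"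
    if y: "y \<in> points d" for x y
  proof -
    define m where "m = y(1 := p 1)"
    define z where "z = m + (m - y)"
    have m_pts: "m \<in> points d" using y d by (auto simp: points_def PiE_def extensional_def m_def)
    have m: "m' \<in> points d \<and> [m', p] \<in> Simul d \<and> [m', y] \<in> Rest d \<longleftrightarrow> m' = m" for m'
    proof
      assume m': "m' \<in> points d \<and> [m', p] \<in> Simul d \<and> [m', y] \<in> Rest d"
      show "m' = m"
      proof (rule points_eqI[OF _ m_pts])
        show "m' \<in> points d" using m' by blast
        fix i assume "i \<in> {1..d}"
        then have "i = 1 \<or> i \<in> {2..d}" by auto
        then show "m' i = m i" using m' by (auto simp: m_def Simul_def Rest_def)
      qed
    next
      assume "m' = m"
      then show "m' \<in> points d \<and> [m', p] \<in> Simul d \<and> [m', y] \<in> Rest d"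
        using m_pts y pts by (auto simp: Simul_def Rest_def m_def)
    qed
    have "(\<exists>m'\<in>points d. [m', p] \<in> Simul d \<and> [m', y] \<in> Rest d \<and> P m') \<longleftrightarrow> P m" for P
      by (metis m)
    then have "(\<exists>m\<in>points d. [m, p] \<in> Simul d \<and> [m, y] \<in> Rest d \<and>
      (\<exists>z\<in>points d. m - y = z - m \<and> orthogonal d q x p z)) \<longleftrightarrow>
      (\<exists>z\<in>points d. m - y = z - m \<and> orthogonal d q x p z)"
      by this
    also have "\<dots> \<longleftrightarrow> orthogonal d q x p z"
    proof -
      have "m - y = z' - m \<longleftrightarrow> z' = z" for z'
        by (auto simp: z_def fun_eq_iff algebra_simps)
      moreover have "z \<in> points d" using m_pts y unfolding z_def by (intro points_add points_diff)
      ultimately show ?thesis by auto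
    qed
    also have "z - p = (y - p)(1 := - (y - p) 1)"
      by (auto simp: z_def m_def fun_eq_iff)
    then have "orthogonal d q x p z \<longleftrightarrow> eform d (x - q) (y - p) = 0"
      using d by (simp only: orthogonal_def) (simp only: mform_time_reflection neg_equal_0_iff_equal)
    finally show ?thesis .
  qed
  have shift: "v = x - p \<longleftrightarrow> x = p + v" "u = y - x \<longleftrightarrow> y = x + u" for x y
    by (auto simp: fun_eq_iff algebra_simps)
  have "eform d (p + v - q) (p + v + u - p) = 0 \<longleftrightarrow> eform d u u = eform d v v"
  proof -
    have "(p + v) - q = v - u" "(p + v + u) - p = v + u" by (simp_all add: u_def fun_eq_iff)
    then have "eform d (p + v - q) (p + v + u - p) = eform d (v - u) (v + u)" by (simp only:)
    then show ?thesis using eform_commute[of d u v] by auto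
  qed
  then have "(\<exists>x\<in>points d. x = p + v \<and> (\<exists>y\<in>points d. y = x + u \<and>
      eform d (x - q) (y - p) = 0)) \<longleftrightarrow> eform d u u = eform d v v"
    using pts vecs by (simp del: eform_bilinear)
  then have "(\<exists>x\<in>points d. v = x - p \<and> (\<exists>y\<in>points d. u = y - x \<and>
       (\<exists>m\<in>points d. [m, p] \<in> Simul d \<and> [m, y] \<in> Rest d \<and>
          (\<exists>z\<in>points d. m - y = z - m \<and> orthogonal d q x p z)))) \<longleftrightarrow> eform d u u = eform d v v"
    by (simp only: shift reflect cong: bex_cong)
  then show ?thesis
    using pts by (simp add: Cong_def dist2_eq u_def v_def)
qed

section \<open>Definability in structures with betweenness\<close>

locale affine_structure =
  fixes A :: "'a::linordered_field point rel_structure" and d :: nat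
  assumes universe: "universe A = points d" and dim: "d \<ge> 2" and Bw: "Bw d \<in> Conc A"
begin

lemma expressible_Bex:
  assumes "expressible A (\<lambda>e. P (\<lambda>i. e (Suc i)) (e 0))"
  shows "expressible A (\<lambda>e. \<exists>p\<in>points d. P e p)"
  using expressible_ex[OF assms] by (simp only: universe)

lemma expressible_Ball:
  assumes "expressible A (\<lambda>e. P (\<lambda>i. e (Suc i)) (e 0))"
  shows "expressible A (\<lambda>e. \<forall>p\<in>points d. P e p)"
  using expressible_all[OF assms] by (simp only: universe)

lemmas connectives = expressible_not expressible_conj expressible_disj expressible_imp
  expressible_Bex expressible_Ball expressible_eq

lemma expressible_collinear: "expressible A (\<lambda>e. collinear (e i) (e j) (e k))"
  by (rule expressible_cong, rule collinear_iff_Bw[of _ d])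
    (simp_all only: universe, intro connectives expressible_Conc3 Bw)

lemma expressible_parallel: "expressible A (\<lambda>e. parallel (e i) (e j) (e k) (e l))"
  by (rule expressible_cong, rule parallel_iff_collinear[of _ d])
    (simp_all only: universe, intro connectives expressible_collinear)

lemma expressible_parallelogram: "expressible A (\<lambda>e. parallelogram (e i) (e j) (e k) (e l))"
  by (rule expressible_cong, rule parallelogram_iff_parallel)
    (intro connectives expressible_collinear expressible_parallel)

lemma expressible_translation: "expressible A (\<lambda>e. e j - e i = e l - e k)"
  by (rule expressible_cong, rule translation_iff_parallelogram[OF dim])
    (simp_all only: universe, intro connectives expressible_parallelogram)

lemma Conc2I:
  assumes "expressible A (\<lambda>e. [e 0, e 1] \<in> R)"
    and "\<And>as. as \<in> R \<Longrightarrow> length as = 2 \<and> set as \<subseteq> points d"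
  shows "R \<in> Conc A"
  using assms by (intro Conc_if_expressible[where n = 2]) (auto simp: universe points_nonempty upt_rec)

lemma Conc4I:
  assumes "expressible A (\<lambda>e. [e 0, e 1, e 2, e 3] \<in> R)"
    and "\<And>as. as \<in> R \<Longrightarrow> length as = 4 \<and> set as \<subseteq> points d"
  shows "R \<in> Conc A"
  using assms by (intro Conc_if_expressible[where n = 4])
    (auto simp: universe points_nonempty upt_rec numeral_2_eq_2 numeral_3_eq_3)

lemma Conc3I:
  assumes "expressible A (\<lambda>e. [e 0, e 1, e 2] \<in> R)"
    and "\<And>as. as \<in> R \<Longrightarrow> length as = 3 \<and> set as \<subseteq> points d"
  shows "R \<in> Conc A"
  using assms by (intro Conc_if_expressible[where n = 3])
    (auto simp: universe points_nonempty upt_rec numeral_2_eq_2)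

lemma Light_if_Cong_mu: "Cong_mu d \<in> Conc A \<Longrightarrow> Light d \<in> Conc A"
proof (rule Conc2I)
  assume Cong_mu: "Cong_mu d \<in> Conc A"
  have *: "[p, q] \<in> Light d \<longleftrightarrow> [p, q, p, p] \<in> Cong_mu d"
    if "p \<in> points d" "q \<in> points d" for p q :: "'a point"
    using that by (simp add: Light_def Cong_mu_def mdist2_def)
  show "expressible A (\<lambda>e. [e 0, e 1] \<in> Light d)"
    by (rule expressible_cong, rule *) (simp_all only: universe expressible_Conc4[OF Cong_mu])
qed (auto simp: Light_def)

lemma Simul_if_Cong_S: "Cong_S d \<in> Conc A \<Longrightarrow> Simul d \<in> Conc A"
proof (rule Conc2I)
  assume Cong_S: "Cong_S d \<in> Conc A"
  have *: "[p, q] \<in> Simul d \<longleftrightarrow> [p, q, p, q] \<in> Cong_S d"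
    if "p \<in> points d" "q \<in> points d" for p q :: "'a point"
    using that by (simp add: Simul_def Cong_S_iff)
  show "expressible A (\<lambda>e. [e 0, e 1] \<in> Simul d)"
    by (rule expressible_cong, rule *) (simp_all only: universe expressible_Conc4[OF Cong_S])
qed (auto simp: Simul_def)

end

locale conformal_structure = affine_structure +
  assumes Light: "Light d \<in> Conc A"
begin

lemma expressible_lightlike: "expressible A (\<lambda>e. lightlike d (e i) (e j))"
  by (rule expressible_cong, rule Light_iff[symmetric])
    (simp_all only: universe expressible_Conc2[OF Light])

lemma expressible_orthogonal_to_lightlike:
  "expressible A (\<lambda>e. lightlike d (e i) (e j) \<and> orthogonal d (e i) (e j) (e i) (e k))"
proof -
  have *: "lightlike d p q \<and> orthogonal d p q p r \<longleftrightarrow> lightlike d p q \<and> (p = q \<or> collinear p q r \<or>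
      \<not> lightlike d q r \<and> (\<forall>x\<in>points d. collinear q r x \<and> lightlike d p x \<longrightarrow> x = q))"
    if "p \<in> points d" "q \<in> points d" "r \<in> points d" for p q r :: "'a point"
  proof (cases "p = q")
    case True
    then show ?thesis by (simp add: orthogonal_def)
  next
    case False
    then show ?thesis using orthogonal_to_lightlike_iff[OF that] by blast
  qed
  show ?thesis
    by (rule expressible_cong, rule *)
      (simp_all only: universe, intro connectives expressible_collinear expressible_lightlike)
qed

lemma expressible_orthogonal_same_origin:
  "expressible A (\<lambda>e. orthogonal d (e i) (e j) (e i) (e k))"
proof -
  have *: "orthogonal d p q p r \<longleftrightarrow> (lightlike d p q \<and> orthogonal d p q p r) \<or> \<not> lightlike d p q \<and>
    (\<exists>x\<in>points d. \<exists>y\<in>points d. \<exists>z\<in>points d. parallelogram p x y q \<and>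
       (lightlike d p x \<and> orthogonal d p x p z) \<and> (lightlike d p y \<and> orthogonal d p y p z) \<and>
       (z = r \<or> parallel x y z r))"
    if "p \<in> points d" "q \<in> points d" "r \<in> points d" for p q r :: "'a point"
    using orthogonal_to_nonlightlike_iff[OF dim that] by blast
  show ?thesis
    by (rule expressible_cong, rule *)
      (simp_all only: universe, intro expressible_orthogonal_to_lightlike connectives
        expressible_parallel expressible_parallelogram expressible_lightlike)
qed

lemma expressible_orthogonal: "expressible A (\<lambda>e. orthogonal d (e i) (e j) (e k) (e l))"
  by (rule expressible_cong, rule orthogonal_iff_translate)
    (simp_all only: universe,
      intro connectives expressible_translation expressible_orthogonal_same_origin)

lemma Cong_mu: "Cong_mu d \<in> Conc A"
proof (rule Conc4I)
  show "expressible A (\<lambda>e. [e 0, e 1, e 2, e 3] \<in> Cong_mu d)"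
    by (rule expressible_cong, rule Cong_mu_iff)
      (simp_all only: universe, intro connectives expressible_translation expressible_orthogonal)
qed (auto simp: Cong_mu_def)

end

locale late_classical_structure = conformal_structure +
  assumes Cong_S: "Cong_S d \<in> Conc A"
begin

lemma Simul: "Simul d \<in> Conc A"
  by (rule Simul_if_Cong_S) (rule Cong_S)

lemma Rest: "Rest d \<in> Conc A"
proof (rule Conc2I)
  show "expressible A (\<lambda>e. [e 0, e 1] \<in> Rest d)"
    by (rule expressible_cong, rule Rest_iff_sphere_centre[OF dim])
      (simp_all only: universe, intro connectives expressible_Conc2[OF Simul]
        expressible_Conc2[OF Light] expressible_Conc4[OF Cong_S])
qed (auto simp: Rest_def)

lemma Cong: "Cong d \<in> Conc A"
proof (rule Conc4I)
  show "expressible A (\<lambda>e. [e 0, e 1, e 2, e 3] \<in> Cong d)"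
    by (rule expressible_cong, rule Cong_iff[OF dim])
      (simp_all only: universe, intro connectives expressible_Conc2[OF Simul]
        expressible_Conc2[OF Rest] expressible_translation expressible_orthogonal)
qed (auto simp: Cong_def)

lemma Delta: "Delta d \<in> Conc A"
proof (rule Conc3I)
  have *: "[p, q, r] \<in> Delta d \<longleftrightarrow> [p, q] \<in> Simul d \<and> [p, r] \<in> Light d" for p q r :: "'a point"
    by (simp add: Delta_def)
  show "expressible A (\<lambda>e. [e 0, e 1, e 2] \<in> Delta d)"
    unfolding * by (intro connectives expressible_Conc2[OF Simul] expressible_Conc2[OF Light])
qed (auto simp: Delta_def Simul_def Light_def)

end

section \<open>Linear maps of the plane of the first two coordinates\<close>

text \<open>All symmetries that are needed act on the time axis and one space axis only.  They have rational
  entries and hence exist over every ordered field.\<close>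

definition planar_map :: "'a::field \<Rightarrow> 'a \<Rightarrow> 'a \<Rightarrow> 'a \<Rightarrow> (nat \<Rightarrow> 'a) \<Rightarrow> nat \<Rightarrow> 'a" where
  "planar_map a b c e p = p(1 := a * p 1 + b * p 2, 2 := c * p 1 + e * p 2)"

lemma planar_map_apply [simp]:
  "planar_map a b c e p 1 = a * p 1 + b * p 2"
  "planar_map a b c e p (Suc 0) = a * p 1 + b * p 2"
  "planar_map a b c e p 2 = c * p 1 + e * p 2"
  "i \<noteq> 1 \<Longrightarrow> i \<noteq> 2 \<Longrightarrow> planar_map a b c e p i = p i"
  by (simp_all add: planar_map_def)

lemma planar_map_points:
  "d \<ge> 2 \<Longrightarrow> p \<in> points d \<Longrightarrow> planar_map a b c e p \<in> points d"
  by (auto simp: planar_map_def points_def PiE_def extensional_def)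

lemma planar_map_inverse:
  assumes "a * e - b * c \<noteq> (0 :: 'a::field)"
  defines "D \<equiv> a * e - b * c"
  shows "planar_map (e / D) (- b / D) (- c / D) (a / D) (planar_map a b c e p) = p"
    and "planar_map a b c e (planar_map (e / D) (- b / D) (- c / D) (a / D) p) = p"
proof -
  have D: "D \<noteq> 0" "D = a * e - b * c" using assms by simp_all
  have "planar_map (e / D) (- b / D) (- c / D) (a / D) (planar_map a b c e p) i = p i \<and>
      planar_map a b c e (planar_map (e / D) (- b / D) (- c / D) (a / D) p) i = p i" for i
  proof -
    consider "i = 1" | "i = 2" | "i \<noteq> 1" "i \<noteq> 2" by blast
    then show ?thesis
      by cases (use D(1) in \<open>simp_all add: field_simps\<close>, simp_all add: D(2) algebra_simps)
  qed
  then show "planar_map (e / D) (- b / D) (- c / D) (a / D) (planar_map a b c e p) = p"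
    and "planar_map a b c e (planar_map (e / D) (- b / D) (- c / D) (a / D) p) = p"
    by (simp_all add: fun_eq_iff)
qed

lemma sum_split_2:
  fixes f :: "nat \<Rightarrow> 'a::comm_monoid_add"
  shows "d \<ge> 2 \<Longrightarrow> (\<Sum>i=1..d. f i) = f 1 + (f 2 + (\<Sum>i=3..d. f i))"
    "d \<ge> 2 \<Longrightarrow> (\<Sum>i=2..d. f i) = f 2 + (\<Sum>i=3..d. f i)"
  by (simp_all add: sum.atLeast_Suc_atMost numeral_2_eq_2 numeral_3_eq_3)

lemma planar_map_dist2:
  assumes "d \<ge> 2"
  shows "dist2 d (planar_map a b c e p) (planar_map a b c e q) =
    (a * (p 1 - q 1) + b * (p 2 - q 2))\<^sup>2 + ((c * (p 1 - q 1) + e * (p 2 - q 2))\<^sup>2 +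
    (\<Sum>i=3..d. (p i - q i)\<^sup>2))"
proof -
  have "(\<Sum>i=3..d. (planar_map a b c e p i - planar_map a b c e q i)\<^sup>2) = (\<Sum>i=3..d. (p i - q i)\<^sup>2)"
    by (intro sum.cong) auto
  then show ?thesis
    using assms unfolding dist2_def by (subst sum_split_2) (simp_all add: algebra_simps)
qed

lemma planar_map_mdist2:
  assumes "d \<ge> 2"
  shows "mdist2 d (planar_map a b c e p) (planar_map a b c e q) =
    (a * (p 1 - q 1) + b * (p 2 - q 2))\<^sup>2 - ((c * (p 1 - q 1) + e * (p 2 - q 2))\<^sup>2 +
    (\<Sum>i=3..d. (p i - q i)\<^sup>2))"
proof -
  have "(\<Sum>i=3..d. (planar_map a b c e p i - planar_map a b c e q i)\<^sup>2) = (\<Sum>i=3..d. (p i - q i)\<^sup>2)"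
    by (intro sum.cong) auto
  then show ?thesis
    using assms unfolding mdist2_def by (subst sum_split_2) (simp_all add: algebra_simps)
qed

lemma planar_map_Bw:
  assumes d: "d \<ge> 2" and det: "a * e - b * c \<noteq> 0" and as: "set as \<subseteq> points d"
  shows "map (planar_map a b c e) as \<in> Bw d \<longleftrightarrow> as \<in> Bw d"
proof -
  have *: "map (planar_map a b c e) as \<in> Bw d" if Bw: "as \<in> Bw d"
    for a b c e :: 'a and as
  proof -
    obtain p q r where as: "as = [p, q, r]" "p \<in> points d" "q \<in> points d" "r \<in> points d"
      using Bw by (auto simp: Bw_def)
    with Bw obtain t where t: "0 \<le> t" "t \<le> 1" "q = p + t \<cdot> (r - p)"
      by (auto simp: Bw_iff)
    have "planar_map a b c e q = planar_map a b c e p + t \<cdot> (planar_map a b c e r - planar_map a b c e p)"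
      unfolding t(3) by (auto simp: planar_map_def fun_eq_iff algebra_simps)
    then show ?thesis
      using as t d by (auto simp: Bw_iff planar_map_points)
  qed
  let ?g = "planar_map (e / (a * e - b * c)) (- b / (a * e - b * c)) (- c / (a * e - b * c)) (a / (a * e - b * c))"
  have "map ?g (map (planar_map a b c e) as) = as"
    unfolding map_map comp_def planar_map_inverse(1)[OF det] by simp
  then show ?thesis using * by metis
qed

text \<open>Betweenness is preserved by every invertible linear map, so that only the other relations of the
  structure need to be checked.\<close>

lemma planar_map_Conc:
  assumes d: "d \<ge> 2" and det: "a * e - b * c \<noteq> 0" and A: "universe A = points d"
    and rel: "\<And>n S as. (n, S) \<in> set (relations A) \<Longrightarrow> S \<noteq> Bw d \<Longrightarrow> set as \<subseteq> points d \<Longrightarrow>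
      map (planar_map a b c e) as \<in> S \<longleftrightarrow> as \<in> S"
    and R: "R \<in> Conc A" "as \<in> R"
  shows "map (planar_map a b c e) as \<in> R"
proof (rule Conc_automorphism[OF _ _ _ R])
  let ?f = "planar_map a b c e"
  let ?g = "planar_map (e / (a * e - b * c)) (- b / (a * e - b * c)) (- c / (a * e - b * c)) (a / (a * e - b * c))"
  note inv = planar_map_inverse[OF det]
  show "?f ` universe A = universe A"
    unfolding A
  proof
    show "points d \<subseteq> ?f ` points d"
    proof
      fix p :: "'a point" assume "p \<in> points d"
      then have "?f (?g p) \<in> ?f ` points d" by (intro imageI planar_map_points[OF d])
      then show "p \<in> ?f ` points d" by (simp only: inv(2))
    qed
  qed (auto intro: planar_map_points[OF d])
  show "p = q" if "?f p = ?f q" for p q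
    using inv(1)[of p] inv(1)[of q] unfolding that by simp
  show "map ?f as \<in> S \<longleftrightarrow> as \<in> S"
    if "(n, S) \<in> set (relations A)" "set as \<subseteq> universe A" for n S as
    using that rel[OF that(1)] planar_map_Bw[OF d det] A by (cases "S = Bw d") auto
qed

definition plane_point :: "nat \<Rightarrow> 'a::linordered_field \<Rightarrow> 'a \<Rightarrow> 'a point" where
  "plane_point d s t = (\<lambda>i\<in>{1..d}. if i = 1 then s else if i = 2 then t else 0)"

lemma plane_point_points [simp]: "plane_point d s t \<in> points d"
  by (simp add: plane_point_def points_def)

lemma planar_map_plane_point:
  "d \<ge> 2 \<Longrightarrow> planar_map a b c e (plane_point d s t) = plane_point d (a * s + b * t) (c * s + e * t)"
  by (auto simp: plane_point_def planar_map_def fun_eq_iff)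

lemma plane_point_relations:
  fixes s t s' t' :: "'a::linordered_field"
  assumes d: "d \<ge> 2"
  shows "dist2 d (plane_point d s t) (plane_point d s' t') = (s - s')\<^sup>2 + (t - t')\<^sup>2"
    and "mdist2 d (plane_point d s t) (plane_point d s' t') = (s - s')\<^sup>2 - (t - t')\<^sup>2"
    and "[plane_point d s t, plane_point d s' t'] \<in> Simul d \<longleftrightarrow> s = s'"
    and "[plane_point d s t, plane_point d s' t'] \<in> Rest d \<longleftrightarrow> t = t'"
    and "[plane_point d s t, plane_point d s' t'] \<in> Light d \<longleftrightarrow> (s - s')\<^sup>2 = (t - t')\<^sup>2"
proof -
  have v: "plane_point d s t 1 = s" "plane_point d s t 2 = t" "\<And>i. i \<in> {3..d} \<Longrightarrow> plane_point d s t i = 0"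
    for s t :: 'a
    using d by (auto simp: plane_point_def)
  have "(\<Sum>i=3..d. (plane_point d s t i - plane_point d s' t' i)\<^sup>2) = 0"
    by (intro sum.neutral) (auto simp: v)
  then show "dist2 d (plane_point d s t) (plane_point d s' t') = (s - s')\<^sup>2 + (t - t')\<^sup>2"
    and m: "mdist2 d (plane_point d s t) (plane_point d s' t') = (s - s')\<^sup>2 - (t - t')\<^sup>2"
    unfolding dist2_def mdist2_def sum_split_2[OF d] v by simp_all
  from m show "[plane_point d s t, plane_point d s' t'] \<in> Light d \<longleftrightarrow> (s - s')\<^sup>2 = (t - t')\<^sup>2"
    by (simp add: Light_def mdist2_def v(1)[unfolded One_nat_def])
  show "[plane_point d s t, plane_point d s' t'] \<in> Simul d \<longleftrightarrow> s = s'"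
    unfolding Simul_iff[OF plane_point_points plane_point_points] v ..
  have "{2..d} = insert 2 {3..d}" using d by auto
  then show "[plane_point d s t, plane_point d s' t'] \<in> Rest d \<longleftrightarrow> t = t'"
    by (simp add: Rest_def v)
qed

lemma plane_point_Cong:
  fixes s t :: "'a::linordered_field"
  assumes d: "d \<ge> 2"
  shows "[plane_point d s t, plane_point d s' t', plane_point d u w, plane_point d u' w'] \<in> Cong d \<longleftrightarrow>
      (s - s')\<^sup>2 + (t - t')\<^sup>2 = (u - u')\<^sup>2 + (w - w')\<^sup>2"
    and "[plane_point d s t, plane_point d s' t', plane_point d u w, plane_point d u' w'] \<in> Cong_mu d \<longleftrightarrow>
      (s - s')\<^sup>2 - (t - t')\<^sup>2 = (u - u')\<^sup>2 - (w - w')\<^sup>2"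
    and "[plane_point d s t, plane_point d s' t', plane_point d u w, plane_point d u' w'] \<in> Cong_S d \<longleftrightarrow>
      (s = s' \<and> u = u') \<and> (t - t')\<^sup>2 = (w - w')\<^sup>2"
    and "[plane_point d s t, plane_point d s' t', plane_point d u w] \<in> Delta d \<longleftrightarrow>
      s = s' \<and> (s - u)\<^sup>2 = (t - w)\<^sup>2"
  by (auto simp: Cong_def Cong_mu_def Cong_S_def Delta_def plane_point_relations[OF d])

section \<open>The concept sets of the geometries\<close>

lemma relation_in_Conc:
  assumes "k < length (relations A)" "relations A ! k = (n, R)"
    and R: "\<And>as. as \<in> R \<Longrightarrow> length as = n \<and> set as \<subseteq> universe A"
  shows "R \<in> Conc A"
proof -
  have "sat A ((!) as) (Atom k [0..<n]) \<longleftrightarrow> as \<in> R" if "length as = n" for as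
    using that assms(2) map_nth[of as] by simp
  then have "R = {as. length as = n \<and> set as \<subseteq> universe A \<and> sat A ((!) as) (Atom k [0..<n])}"
    using R by blast
  moreover have "in_language A (Atom k [0..<n])" "free_vars (Atom k [0..<n]) \<subseteq> {..<n}"
    using assms by auto
  ultimately show ?thesis
    unfolding Conc_def definable_def by blast
qed

lemma universe_geom [simp]: "universe (geom F d X) = points d"
  by (cases X) simp_all

lemma geom_basic_relations:
  fixes F :: "'a::linordered_field itself"
  shows "Bw d \<in> Conc (geom F d X)"
    and "Cong d \<in> Conc (geom F d Eucl)"
    and "Light d \<in> Conc (geom F d Rel)"
    and "Cong_mu d \<in> Conc (geom F d Mink)"
    and "Cong_S d \<in> Conc (geom F d Gal)"
    and "Cong_S d \<in> Conc (geom F d Newt)"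
    and "Rest d \<in> Conc (geom F d Newt)"
    and "Cong_S d \<in> Conc (geom F d LClass)"
    and "Light d \<in> Conc (geom F d LClass)"
proof -
  show "Bw d \<in> Conc (geom F d X)"
    by (rule relation_in_Conc[where n = 3 and k = "if X = OAff then 0 else 1"])
      (cases X; auto simp: Bw_def)+
  show "Cong d \<in> Conc (geom F d Eucl)"
    by (rule relation_in_Conc[where n = 4 and k = 0]) (auto simp: Cong_def)
  show "Light d \<in> Conc (geom F d Rel)"
    by (rule relation_in_Conc[where n = 2 and k = 0]) (auto simp: Light_def)
  show "Cong_mu d \<in> Conc (geom F d Mink)"
    by (rule relation_in_Conc[where n = 4 and k = 0]) (auto simp: Cong_mu_def)
  show "Cong_S d \<in> Conc (geom F d Gal)" "Cong_S d \<in> Conc (geom F d Newt)"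
      "Cong_S d \<in> Conc (geom F d LClass)"
    by (rule relation_in_Conc[where n = 4 and k = 0]; auto simp: Cong_S_def Cong_def)+
  show "Rest d \<in> Conc (geom F d Newt)"
    by (rule relation_in_Conc[where n = 2 and k = 2]) (auto simp: Rest_def)
  show "Light d \<in> Conc (geom F d LClass)"
    by (rule relation_in_Conc[where n = 2 and k = 2]) (auto simp: Light_def)
qed

lemma Cong_nth: "as \<in> Cong d \<longleftrightarrow> length as = 4 \<and> set as \<subseteq> points d \<and>
    dist2 d (as ! 0) (as ! 1) = dist2 d (as ! 2) (as ! 3)"
  by (auto simp: Cong_def numeral_eq_Suc length_Suc_conv)

lemma Cong_S_nth: "as \<in> Cong_S d \<longleftrightarrow> length as = 4 \<and> set as \<subseteq> points d \<and>
    dist2 d (as ! 0) (as ! 1) = dist2 d (as ! 2) (as ! 3) \<and>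
    (as ! 0) 1 = (as ! 1) 1 \<and> (as ! 2) 1 = (as ! 3) 1"
  by (auto simp: Cong_S_def Cong_def Simul_def numeral_eq_Suc length_Suc_conv)

lemma Light_nth: "as \<in> Light d \<longleftrightarrow> length as = 2 \<and> set as \<subseteq> points d \<and>
    mdist2 d (as ! 0) (as ! 1) = 0"
  by (auto simp: Light_def mdist2_def numeral_eq_Suc length_Suc_conv)

lemma Rest_nth: "as \<in> Rest d \<longleftrightarrow> length as = 2 \<and> set as \<subseteq> points d \<and>
    (\<forall>i\<in>{2..d}. (as ! 0) i = (as ! 1) i)"
  by (auto simp: Rest_def numeral_eq_Suc length_Suc_conv)

lemma planar_map_list:
  assumes "d \<ge> 2" "set as \<subseteq> points d"
  shows "set (map (planar_map a b c e) as) \<subseteq> points d"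
  using assms by (auto intro: planar_map_points)

text \<open>The Pythagorean triple \<open>3\<close>, \<open>4\<close>, \<open>5\<close> gives a rotation without square roots.\<close>

lemma Eucl_rotation:
  fixes F :: "'a::linordered_field itself"
  assumes d: "d \<ge> 2" and R: "R \<in> Conc (geom F d Eucl)" "as \<in> R"
  shows "map (planar_map (3/5) (- 4/5) (4/5) (3/5)) as \<in> R"
proof (rule planar_map_Conc[OF d _ _ _ R])
  let ?f = "planar_map (3/5) (- 4/5) (4/5) (3/5 :: 'a)"
  have "dist2 d (?f p) (?f q) = dist2 d p q" for p q
  proof -
    have "(3/5 * x + - 4/5 * y)\<^sup>2 + (4/5 * x + 3/5 * y)\<^sup>2 = x\<^sup>2 + y\<^sup>2" for x y :: 'a
      by (simp add: power2_eq_square field_simps)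
    then show ?thesis
      unfolding planar_map_dist2[OF d] unfolding dist2_def sum_split_2[OF d] add.assoc[symmetric] by (simp only:)
  qed
  then have "map ?f as \<in> Cong d \<longleftrightarrow> as \<in> Cong d" if "set as \<subseteq> points d" for as
    using that planar_map_list[OF d that] by (auto simp: Cong_nth)
  then show "map ?f as \<in> S \<longleftrightarrow> as \<in> S"
    if "(n, S) \<in> set (relations (geom F d Eucl))" "S \<noteq> Bw d" "set as \<subseteq> points d" for n S as
    using that by auto
qed simp_all

text \<open>The same triple gives a Lorentz boost, because \<open>(5/4)\<^sup>2 - (3/4)\<^sup>2 = 1\<close>.\<close>

lemma Rel_boost:
  fixes F :: "'a::linordered_field itself"
  assumes d: "d \<ge> 2" and R: "R \<in> Conc (geom F d Rel)" "as \<in> R"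
  shows "map (planar_map (5/4) (3/4) (3/4) (5/4)) as \<in> R"
proof (rule planar_map_Conc[OF d _ _ _ R])
  let ?f = "planar_map (5/4) (3/4) (3/4) (5/4 :: 'a)"
  have "mdist2 d (?f p) (?f q) = mdist2 d p q" for p q
  proof -
    have "(5/4 * x + 3/4 * y)\<^sup>2 - (3/4 * x + 5/4 * y)\<^sup>2 = x\<^sup>2 - y\<^sup>2" for x y :: 'a
      by (simp add: power2_eq_square field_simps)
    then show ?thesis
      unfolding planar_map_mdist2[OF d] unfolding mdist2_def sum_split_2[OF d] diff_diff_add[symmetric] by (simp only:)
  qed
  then have "map ?f as \<in> Light d \<longleftrightarrow> as \<in> Light d" if "set as \<subseteq> points d" for as
    using that planar_map_list[OF d that] by (auto simp: Light_nth)
  then show "map ?f as \<in> S \<longleftrightarrow> as \<in> S"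
    if "(n, S) \<in> set (relations (geom F d Rel))" "S \<noteq> Bw d" "set as \<subseteq> points d" for n S as
    using that by auto
qed (simp_all add: field_simps)

lemma planar_map_Cong_S:
  assumes d: "d \<ge> 2" and "a \<noteq> 0" and as: "set as \<subseteq> points d"
  shows "map (planar_map a 0 c 1) as \<in> Cong_S d \<longleftrightarrow> as \<in> Cong_S d"
proof -
  have "dist2 d (planar_map a 0 c 1 p) (planar_map a 0 c 1 q) = dist2 d p q"
    if "p 1 = q 1" for p q
    using that unfolding planar_map_dist2[OF d] unfolding dist2_def sum_split_2[OF d] by simp
  then show ?thesis
    using \<open>a \<noteq> 0\<close> as planar_map_list[OF d as] by (auto simp: Cong_S_nth)
qed

text \<open>A Galilean boost: it tilts the time axis and fixes every vector between simultaneous events.\<close>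

lemma Gal_shear:
  fixes F :: "'a::linordered_field itself"
  assumes d: "d \<ge> 2" and R: "R \<in> Conc (geom F d Gal)" "as \<in> R"
  shows "map (planar_map 1 0 1 1) as \<in> R"
  by (rule planar_map_Conc[OF d _ _ _ R]) (auto simp: planar_map_Cong_S[OF d])

text \<open>Nothing in Newtonian spacetime relates the unit of time to that of length.\<close>

lemma Newt_time_dilation:
  fixes F :: "'a::linordered_field itself"
  assumes d: "d \<ge> 2" and R: "R \<in> Conc (geom F d Newt)" "as \<in> R"
  shows "map (planar_map 2 0 0 1) as \<in> R"
proof (rule planar_map_Conc[OF d _ _ _ R])
  let ?f = "planar_map 2 0 0 (1 :: 'a)"
  have "?f p i = p i" if "i \<in> {2..d}" for p i
    using that by (cases "i = 2") auto
  then have "map ?f as \<in> Rest d \<longleftrightarrow> as \<in> Rest d" if "set as \<subseteq> points d" for as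
    using that planar_map_list[OF d that] by (auto simp: Rest_nth)
  then show "map ?f as \<in> S \<longleftrightarrow> as \<in> S"
    if "(n, S) \<in> set (relations (geom F d Newt))" "S \<noteq> Bw d" "set as \<subseteq> points d" for n S as
    using that planar_map_Cong_S[OF d, of 2] by auto
qed simp_all

text \<open>For each relation, a tuple of points in the plane of the first two coordinates that satisfies the
  relation while its image under the rotation does not.\<close>

lemma not_in_Conc_Eucl:
  fixes F :: "'a::linordered_field itself"
  assumes d: "d \<ge> 2"
  shows "{Cong_mu d, Light d, Cong_S d, Simul d, Rest d, Delta d} \<inter> Conc (geom F d Eucl) = {}"
proof -
  let ?v = "plane_point d :: 'a \<Rightarrow> _"
  note s = planar_map_plane_point[OF d] plane_point_Cong[OF d] plane_point_relations[OF d] power2_eq_square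
  show ?thesis
    using Eucl_rotation[OF d, of "Cong_mu d" F "[?v 0 0, ?v 1 1, ?v 0 0, ?v 0 0]"]
      Eucl_rotation[OF d, of "Light d" F "[?v 0 0, ?v 1 1]"]
      Eucl_rotation[OF d, of "Cong_S d" F "[?v 0 0, ?v 0 1, ?v 0 0, ?v 0 1]"]
      Eucl_rotation[OF d, of "Simul d" F "[?v 0 0, ?v 0 1]"]
      Eucl_rotation[OF d, of "Rest d" F "[?v 0 0, ?v 1 0]"]
      Eucl_rotation[OF d, of "Delta d" F "[?v 0 0, ?v 0 0, ?v 1 1]"]
    by (auto simp: s)
qed

lemma not_in_Conc_Rel:
  fixes F :: "'a::linordered_field itself"
  assumes d: "d \<ge> 2"
  shows "{Cong d, Cong_S d, Simul d, Rest d, Delta d} \<inter> Conc (geom F d Rel) = {}"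
proof -
  let ?v = "plane_point d :: 'a \<Rightarrow> _"
  note s = planar_map_plane_point[OF d] plane_point_Cong[OF d] plane_point_relations[OF d] power2_eq_square
  show ?thesis
    using Rel_boost[OF d, of "Cong d" F "[?v 0 0, ?v 1 1, ?v 0 0, ?v 1 (- 1)]"]
      Rel_boost[OF d, of "Cong_S d" F "[?v 0 0, ?v 0 1, ?v 0 0, ?v 0 1]"]
      Rel_boost[OF d, of "Simul d" F "[?v 0 0, ?v 0 1]"]
      Rel_boost[OF d, of "Rest d" F "[?v 0 0, ?v 1 0]"]
      Rel_boost[OF d, of "Delta d" F "[?v 0 0, ?v 0 1, ?v 0 0]"]
    by (auto simp: s)
qed

lemma not_in_Conc_Gal:
  fixes F :: "'a::linordered_field itself"
  assumes d: "d \<ge> 2"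
  shows "{Cong d, Cong_mu d, Light d, Rest d, Delta d} \<inter> Conc (geom F d Gal) = {}"
proof -
  let ?v = "plane_point d :: 'a \<Rightarrow> _"
  note s = planar_map_plane_point[OF d] plane_point_Cong[OF d] plane_point_relations[OF d] power2_eq_square
  show ?thesis
    using Gal_shear[OF d, of "Cong d" F "[?v 0 0, ?v 1 0, ?v 0 0, ?v 0 1]"]
      Gal_shear[OF d, of "Cong_mu d" F "[?v 0 0, ?v 1 1, ?v 0 0, ?v 0 0]"]
      Gal_shear[OF d, of "Light d" F "[?v 0 0, ?v 1 1]"]
      Gal_shear[OF d, of "Rest d" F "[?v 0 0, ?v 1 0]"]
      Gal_shear[OF d, of "Delta d" F "[?v 0 0, ?v 0 0, ?v 1 1]"]
    by (auto simp: s)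
qed

lemma not_in_Conc_Newt:
  fixes F :: "'a::linordered_field itself"
  assumes d: "d \<ge> 2"
  shows "{Cong d, Cong_mu d, Light d, Delta d} \<inter> Conc (geom F d Newt) = {}"
proof -
  let ?v = "plane_point d :: 'a \<Rightarrow> _"
  note s = planar_map_plane_point[OF d] plane_point_Cong[OF d] plane_point_relations[OF d] power2_eq_square
  show ?thesis
    using Newt_time_dilation[OF d, of "Cong d" F "[?v 0 0, ?v 1 0, ?v 0 0, ?v 0 1]"]
      Newt_time_dilation[OF d, of "Cong_mu d" F "[?v 0 0, ?v 1 1, ?v 0 0, ?v 0 0]"]
      Newt_time_dilation[OF d, of "Light d" F "[?v 0 0, ?v 1 1]"]
      Newt_time_dilation[OF d, of "Delta d" F "[?v 0 0, ?v 0 0, ?v 1 1]"]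
    by (auto simp: s)
qed

theorem theorem3p2p2:
  fixes F :: "'a::linordered_field itself" and d :: nat
  assumes "d \<ge> 2"
  shows
    "(\<forall>X Y. Conc (geom F d X) \<subseteq> Conc (geom F d Y) \<longleftrightarrow>
        X = Y \<or> {X, Y} = {Rel, Mink} \<or> X = OAff \<or> Y = LClass \<or> X = Gal \<and> Y = Newt)
   \<and> Conc (geom F d Rel) = Conc (geom F d Mink)
   \<and> definitionally_equivalent (geom F d Rel) (geom F d Mink)
   \<and> Conc (geom F d Gal) \<subseteq> Conc (geom F d Newt)
   \<and> Conc (geom F d OAff) \<subseteq> Conc (geom F d Eucl) \<inter> Conc (geom F d Rel) \<inter> Conc (geom F d Gal)
   \<and> Conc (geom F d Eucl) \<union> Conc (geom F d Rel) \<union> Conc (geom F d Newt) \<subseteq> Conc (geom F d LClass)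
   \<and> {Cong d} \<subseteq> Conc (geom F d Eucl)
   \<and> {Cong_mu d, Light d, Cong_S d, Simul d, Rest d, Delta d} \<inter> Conc (geom F d Eucl) = {}
   \<and> {Cong_mu d, Light d} \<subseteq> Conc (geom F d Rel)
   \<and> {Cong d, Cong_S d, Simul d, Rest d, Delta d} \<inter> Conc (geom F d Rel) = {}
   \<and> {Cong_S d, Simul d} \<subseteq> Conc (geom F d Gal)
   \<and> {Cong d, Cong_mu d, Light d, Rest d, Delta d} \<inter> Conc (geom F d Gal) = {}
   \<and> {Cong_S d, Simul d, Rest d} \<subseteq> Conc (geom F d Newt)
   \<and> {Cong d, Cong_mu d, Light d, Delta d} \<inter> Conc (geom F d Newt) = {}
   \<and> {Cong d, Cong_mu d, Light d, Cong_S d, Simul d, Rest d, Delta d} \<subseteq> Conc (geom F d LClass)"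
proof -
  note basic [simp] = geom_basic_relations[where F = F and d = d]
  have affine: "affine_structure (geom F d X) d" for X
    using assms by unfold_locales (simp_all del: geom.simps)
  interpret Rel: conformal_structure "geom F d Rel" d
    by (intro conformal_structure.intro affine conformal_structure_axioms.intro basic)
  interpret LClass: late_classical_structure "geom F d LClass" d
    by (intro late_classical_structure.intro conformal_structure.intro affine
        conformal_structure_axioms.intro late_classical_structure_axioms.intro basic)
  define C where "C X = Conc (geom F d X)" for X
  note basic_C [simp] = geom_basic_relations[where F = F and d = d, folded C_def]
  note Rel_C = Rel.Cong_mu[folded C_def]
  note LClass_C = LClass.Cong[folded C_def] LClass.Cong_mu[folded C_def]
    LClass.Simul[folded C_def] LClass.Rest[folded C_def] LClass.Delta[folded C_def]
  note negative = not_in_Conc_Eucl[OF assms, of F, folded C_def]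
    not_in_Conc_Rel[OF assms, of F, folded C_def]
    not_in_Conc_Gal[OF assms, of F, folded C_def] not_in_Conc_Newt[OF assms, of F, folded C_def]
  have subI: "C X \<subseteq> C Y" if "snd ` set (relations (geom F d X)) \<subseteq> C Y" for X Y
    unfolding C_def
    by (rule Conc_subsetI) (use that in \<open>force simp: C_def points_nonempty simp del: geom.simps\<close>)+
  have Rel_Mink: "C Rel = C Mink"
  proof
    show "C Rel \<subseteq> C Mink"
      using affine_structure.Light_if_Cong_mu[OF affine, of Mink, folded C_def] by (intro subI) simp
    show "C Mink \<subseteq> C Rel"
      using Rel_C by (intro subI) simp
  qed
  have Light_Mink: "Light d \<in> C Mink"
    unfolding Rel_Mink[symmetric] by simp
  have Gal_Newt: "C Gal \<subseteq> C Newt"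
    by (intro subI) simp
  have OAff: "C OAff \<subseteq> C X" for X
    by (intro subI) simp
  have LClass: "C X \<subseteq> C LClass" for X
    using LClass_C by (intro subI) (cases X; simp)
  have Simul: "Simul d \<in> C Gal" "Simul d \<in> C Newt"
    using affine_structure.Simul_if_Cong_S[OF affine, folded C_def] by simp_all
  have inclusions: "C X \<subseteq> C Y \<longleftrightarrow>
      X = Y \<or> {X, Y} = {Rel, Mink} \<or> X = OAff \<or> Y = LClass \<or> X = Gal \<and> Y = Newt" for X Y
  proof
    \<comment> \<open>Four relations separate all concept sets that are to be distinguished.\<close>
    have table:
      "(Cong d \<in> C X, Light d \<in> C X, Cong_S d \<in> C X, Rest d \<in> C X) =
       (X \<in> {Eucl, LClass}, X \<in> {Rel, Mink, LClass}, X \<in> {Gal, Newt, LClass}, X \<in> {Newt, LClass})"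
      for X
      using negative OAff[of Eucl] OAff[of Rel] LClass_C Rel_Mink[symmetric] by (cases X) auto
    assume "C X \<subseteq> C Y"
    then have "R \<in> C X \<longrightarrow> R \<in> C Y" for R by blast
    from this[of "Cong d"] this[of "Light d"] this[of "Cong_S d"] this[of "Rest d"]
    show "X = Y \<or> {X, Y} = {Rel, Mink} \<or> X = OAff \<or> Y = LClass \<or> X = Gal \<and> Y = Newt"
      using table[of X] table[of Y] by (cases X; cases Y) (simp_all add: insert_commute)
  next
    assume "X = Y \<or> {X, Y} = {Rel, Mink} \<or> X = OAff \<or> Y = LClass \<or> X = Gal \<and> Y = Newt"
    then show "C X \<subseteq> C Y"
      using Rel_Mink Gal_Newt OAff[of Y] LClass[of X] by (auto simp: doubleton_eq_iff)
  qed
  show ?thesis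
    unfolding definitionally_equivalent_def C_def[symmetric] universe_geom
    using inclusions Rel_Mink Light_Mink Gal_Newt OAff LClass Simul negative LClass_C Rel_C
    by (simp only: insert_subset empty_subsetI Int_subset_iff Un_subset_iff basic_C simp_thms)
qed

end
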